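(* There exist an absolute constant $c>0$, an absolute constant $C>0$, and an online algorithm for packing integer programs in the Prophet-with-Augmentations model such that, whenever $B\ge C\log d$, for every base instance $((a_1,\mathcal{D}_1),\ldots,(a_n,\mathcal{D}_n),B)$ and every (adaptive) adversary choosing the augmentations, the algorithm selects a feasible set of items whose expected total observed value is at least $c\cdot \mathrm{OPT}_{base}$.
   Context: Prophet-with-Augmentations model for packing integer programs. A base instance $((a_1,\mathcal{D}_1),\ldots,(a_n,\mathcal{D}_n),B)$ consists of $n$ items; item $t$ has a known deterministic size vector $a_t\in[0,1]^d$ and an initially unknown value $V_t\ge 0$ drawn independently from a known distribution $\mathcal{D}_t$. Items are processed in order $t=1,\ldots,n$. Before the $t$-th value is revealed, an adversary adds a perturbation $R_t\ge 0$, which may depend on the history up to and including time $t$ (in particular on $V_1,\ldots,V_t$) and on the algorithm's decisions up to time $t-1$. The algorithm sees $C_t:=V_t+R_t$ and must immediately and irrevocably decide $x_t\in\{0,1\}$ (pick or reject item $t$). The picked items must satisfy $\sum_t a_t x_t\le B\cdot\mathbf{1}$ (with $\mathbf 1$ the all-ones vector in $\mathbb{R}^d$), and the algorithm's value is $\sum_t C_t x_t$. The benchmark is $\mathrm{OPT}_{base}:=\mathbb{E}\big[\max\{\sum_t V_t x_t : \sum_t a_t x_t\le B\mathbf 1,\ x\in\{0,1\}^n\}\big]$, the expected offline optimum of the unperturbed instance. *)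

theory Defs
  imports "HOL-Probability.Probability"
begin

text \<open>
  Items are numbered \<open>0..<n_items I\<close> and coordinates \<open>0..<n_dims I\<close>; the dimension is a field
  (not a type) because the constants of the theorem must not depend on it. The functions in the
  record are only meaningful on these index ranges.
\<close>

record base_instance =
  n_items :: nat
  n_dims :: nat
  item_size :: "nat \<Rightarrow> nat \<Rightarrow> real"
  value_dist :: "nat \<Rightarrow> real measure"
  budget :: real

text \<open>No moment assumption is made on the value distributions: expectations are taken in
  \<^typ>\<open>ennreal\<close>.\<close>

definition valid_instance :: "base_instance \<Rightarrow> bool" where
  "valid_instance I \<longleftrightarrow>
     n_dims I \<ge> 1 \<and>
     (\<forall>t<n_items I. \<forall>i<n_dims I. item_size I t i \<in> {0..1}) \<and>
     (\<forall>t<n_items I. prob_space (value_dist I t) \<and> sets (value_dist I t) = sets borel \<and>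
                    (AE x in value_dist I t. 0 \<le> x))"

text \<open>A vector \<open>x \<in> {0,1}\<^sup>n\<close> is represented by the set of items \<open>t\<close> with \<open>x\<^sub>t = 1\<close>.\<close>

definition feasible :: "base_instance \<Rightarrow> nat set \<Rightarrow> bool" where
  "feasible I S \<longleftrightarrow>
     S \<subseteq> {..<n_items I} \<and> (\<forall>i<n_dims I. (\<Sum>t\<in>S. item_size I t i) \<le> budget I)"

definition values_measure :: "base_instance \<Rightarrow> (nat \<Rightarrow> real) measure" where
  "values_measure I = (\<Pi>\<^sub>M t\<in>{..<n_items I}. value_dist I t)"

definition opt_base :: "base_instance \<Rightarrow> ennreal" where
  "opt_base I = (\<integral>\<^sup>+ v. ennreal (Max {\<Sum>t\<in>S. v t |S. feasible I S}) \<partial>values_measure I)"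

text \<open>
  A real sequence indexed by the times \<open>0..t\<close> is an element of the space of
  \<open>history_space t\<close>, i.e. a function that is \<^const>\<open>undefined\<close> outside \<open>{..t}\<close>.
\<close>

abbreviation history_space :: "nat \<Rightarrow> (nat \<Rightarrow> real) measure" where
  "history_space t \<equiv> (\<Pi>\<^sub>M s\<in>{..t}. borel)"

text \<open>
  A policy decides at time \<open>t\<close> from the observed values \<open>C\<^sub>0, \<dots>, C\<^sub>t\<close>; its own earlier decisions are
  determined by these. An online algorithm knows the base instance and so picks a policy for it.
\<close>

type_synonym policy = "nat \<Rightarrow> (nat \<Rightarrow> real) \<Rightarrow> bool"
type_synonym online_algorithm = "base_instance \<Rightarrow> policy"

definition measurable_policy :: "base_instance \<Rightarrow> policy \<Rightarrow> bool" where
  "measurable_policy I P \<longleftrightarrow>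
     (\<forall>t<n_items I. P t \<in> measurable (history_space t) (count_space UNIV))"

text \<open>
  \<open>R t v S\<close> is the augmentation of item \<open>t\<close> when the base values up to and including time \<open>t\<close> are
  \<open>v\<close> and the items picked before time \<open>t\<close> are \<open>S\<close>. Earlier augmentations are functions of these data.
\<close>

type_synonym adversary = "nat \<Rightarrow> (nat \<Rightarrow> real) \<Rightarrow> nat set \<Rightarrow> real"

definition valid_adversary :: "base_instance \<Rightarrow> adversary \<Rightarrow> bool" where
  "valid_adversary I R \<longleftrightarrow>
     (\<forall>t<n_items I. \<forall>S\<subseteq>{..<t}.
        (\<lambda>v. R t v S) \<in> borel_measurable (history_space t) \<and>
        (\<forall>v\<in>space (history_space t). 0 \<le> R t v S))"

text \<open>
  The state after the first \<open>t\<close> steps: the observed values \<open>C\<^sub>0, \<dots>, C\<^bsub>t-1\<^esub>\<close> and the set of picked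
  items. The observed values stay \<^const>\<open>undefined\<close> at future times, so the policy is called
  on an element of \<open>history_space t\<close> and cannot look ahead.
\<close>

primrec run :: "policy \<Rightarrow> adversary \<Rightarrow> (nat \<Rightarrow> real) \<Rightarrow> nat \<Rightarrow> (nat \<Rightarrow> real) \<times> nat set" where
  "run P R v 0 = ((\<lambda>_. undefined), {})"
| "run P R v (Suc t) =
     (let (C, S) = run P R v t;
          C' = C(t := v t + R t (restrict v {..t}) S)
      in (C', if P t C' then insert t S else S))"

definition observed :: "base_instance \<Rightarrow> policy \<Rightarrow> adversary \<Rightarrow> (nat \<Rightarrow> real) \<Rightarrow> nat \<Rightarrow> real" where
  "observed I P R v = fst (run P R v (n_items I))"

definition picked :: "base_instance \<Rightarrow> policy \<Rightarrow> adversary \<Rightarrow> (nat \<Rightarrow> real) \<Rightarrow> nat set" where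
  "picked I P R v = snd (run P R v (n_items I))"

definition expected_value :: "base_instance \<Rightarrow> policy \<Rightarrow> adversary \<Rightarrow> ennreal" where
  "expected_value I P R =
     (\<integral>\<^sup>+ v. ennreal (\<Sum>t\<in>picked I P R v. observed I P R v t) \<partial>values_measure I)"

end

theory Submission
  imports Defs
begin

text \<open>
  Let \<open>y\<^sub>t\<close> be the probability that item \<open>t\<close> belongs to the offline optimum and \<open>v\<^sub>t\<close> its expected
  contribution there. Post a price \<open>p\<^sub>t\<close> that depends only on past decisions, and pick every item whose
  observed value reaches it. Since \<open>C\<^sub>t \<ge> V\<^sub>t\<close> and \<open>V\<^sub>t\<close> is independent of the past, step \<open>t\<close> earns in
  expectation at least the revenue \<open>p\<^sub>t x\<^sub>t\<close> plus \<open>v\<^sub>t - p\<^sub>t y\<^sub>t\<close>, whatever the adversary does; this also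
  holds after scaling \<open>v\<close> and \<open>y\<close> down by a constant.

  For \<open>d \<ge> 2\<close> take \<open>p\<^sub>t = (OPT / B) \<langle>\<lambda>\<^sub>t, a\<^sub>t\<rangle>\<close>, where \<open>\<lambda>\<^sub>t\<close> are multiplicative weights for the gains
  \<open>a\<^bsub>t,i\<^esub> (x\<^sub>t - y\<^sub>t / 2)\<close>, the actual minus half the ex-ante load, and one expert with zero gain. The total
  gain is then at least \<open>- O(log d)\<close>, so an algorithm that never runs out of budget keeps a constant
  fraction of OPT. When some coordinate becomes full the regret bound gives a gain of order \<open>B\<close>, that is,
  value of order OPT, and the algorithm may stop.

  For \<open>d = 1\<close> the budget need not be large. One of the two classes of items, those of size at most
  \<open>B / 2\<close> and the larger ones, carries half of OPT, and a static price suffices on either class.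
\<close>

section \<open>Posted-price policies\<close>

text \<open>A policy receives only observed values, so its own earlier picks are replayed from them.
  \<open>al\<close> decides whether an item may be bought at all given the picks so far;
  \<open>pr\<close> is the posted price.\<close>

primrec price_picks ::
  "(nat \<Rightarrow> nat set \<Rightarrow> bool) \<Rightarrow> (nat \<Rightarrow> nat set \<Rightarrow> real) \<Rightarrow> nat \<Rightarrow> (nat \<Rightarrow> real) \<Rightarrow> nat set" where
  "price_picks al pr 0 C = {}"
| "price_picks al pr (Suc t) C =
     (if al t (price_picks al pr t C) \<and> pr t (price_picks al pr t C) \<le> C t
      then insert t (price_picks al pr t C) else price_picks al pr t C)"

definition price_policy ::
  "(nat \<Rightarrow> nat set \<Rightarrow> bool) \<Rightarrow> (nat \<Rightarrow> nat set \<Rightarrow> real) \<Rightarrow> policy" where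
  "price_policy al pr t C \<longleftrightarrow>
     al t (price_picks al pr t C) \<and> pr t (price_picks al pr t C) \<le> C t"

lemma price_picks_cong:
  "(\<And>s. s < t \<Longrightarrow> C s = C' s) \<Longrightarrow> price_picks al pr t C = price_picks al pr t C'"
  by (induction t) auto

lemma countable_Pow_lessThan: "countable (Pow {..<t::nat})"
  by (simp add: countable_finite)

text \<open>The pick set takes countably many values, and on each of them \<open>al\<close> and
  \<open>pr\<close> are constant, so only comparisons of \<open>c\<close> with fixed numbers
  remain.\<close>

lemma measurable_price_step:
  fixes X :: "'b \<Rightarrow> nat set"
  assumes X: "X \<in> measurable M (count_space (Pow {..<t}))"
    and c: "c \<in> borel_measurable M"
  shows "Measurable.pred M (\<lambda>w. al (X w) \<and> pr (X w) \<le> (c w :: real))"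
  by (rule measurable_compose_countable'[OF _ X countable_Pow_lessThan,
        where f = "\<lambda>S w. al S \<and> pr S \<le> c w"]) (use c in measurable)

lemma measurable_picks_Suc:
  fixes X :: "'b \<Rightarrow> nat set"
  assumes X: "X \<in> measurable M (count_space (Pow {..<t}))"
    and P: "Measurable.pred M P"
  shows "(\<lambda>w. if P w then insert t (X w) else X w) \<in> measurable M (count_space (Pow {..<Suc t}))"
proof (rule measurable_If[OF _ _ P[unfolded pred_def]])
  have "insert t \<in> measurable (count_space (Pow {..<t})) (count_space (Pow {..<Suc t}))"
    by auto
  from measurable_compose[OF X this]
  show "(\<lambda>w. insert t (X w)) \<in> measurable M (count_space (Pow {..<Suc t}))" .
  have "(\<lambda>S. S) \<in> measurable (count_space (Pow {..<t})) (count_space (Pow {..<Suc t}))"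
    by auto
  from measurable_compose[OF X this]
  show "X \<in> measurable M (count_space (Pow {..<Suc t}))" .
qed

lemma measurable_price_picks:
  "t \<le> Suc m \<Longrightarrow> price_picks al pr t \<in> measurable (history_space m) (count_space (Pow {..<t}))"
proof (induction t)
  case 0
  then show ?case by (simp add: measurable_const)
next
  case (Suc t)
  then have IH: "price_picks al pr t \<in> measurable (history_space m) (count_space (Pow {..<t}))"
    by simp
  have c: "(\<lambda>C. C t) \<in> borel_measurable (history_space m)"
    using Suc.prems by (intro measurable_component_singleton) auto
  show ?case
    using measurable_picks_Suc[OF IH measurable_price_step[OF IH c]] by simp
qed

lemma measurable_price_policy: "measurable_policy I (price_policy al pr)"
  unfolding measurable_policy_def
proof (intro allI impI)
  fix t
  have c: "(\<lambda>C. C t) \<in> borel_measurable (history_space t)"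
    by (intro measurable_component_singleton) auto
  have "Measurable.pred (history_space t)
      (\<lambda>C. al t (price_picks al pr t C) \<and> pr t (price_picks al pr t C) \<le> C t)"
    by (rule measurable_price_step[OF measurable_price_picks c]) simp
  then show "price_policy al pr t \<in> measurable (history_space t) (count_space UNIV)"
    unfolding price_policy_def[abs_def] .
qed

section \<open>The run of a posted-price policy against an adversary\<close>

definition run_picks ::
  "(nat \<Rightarrow> nat set \<Rightarrow> bool) \<Rightarrow> (nat \<Rightarrow> nat set \<Rightarrow> real) \<Rightarrow> adversary \<Rightarrow> (nat \<Rightarrow> real) \<Rightarrow> nat \<Rightarrow> nat set" where
  "run_picks al pr R v t = snd (run (price_policy al pr) R v t)"

definition run_obs ::
  "(nat \<Rightarrow> nat set \<Rightarrow> bool) \<Rightarrow> (nat \<Rightarrow> nat set \<Rightarrow> real) \<Rightarrow> adversary \<Rightarrow> (nat \<Rightarrow> real) \<Rightarrow> nat \<Rightarrow> real" where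
  "run_obs al pr R v t = v t + R t (restrict v {..t}) (run_picks al pr R v t)"

lemma fst_run_Suc:
  "fst (run (price_policy al pr) R v (Suc t)) =
     (fst (run (price_policy al pr) R v t))(t := run_obs al pr R v t)"
  by (simp add: Let_def split_beta run_obs_def run_picks_def)

lemma fst_run: "s < t \<Longrightarrow> fst (run (price_policy al pr) R v t) s = run_obs al pr R v s"
  by (induction t) (auto simp: fst_run_Suc less_Suc_eq simp del: run.simps)

text \<open>The replay agrees with the actual run because writing the observation of time
  \<open>t\<close> leaves the earlier entries, from which the earlier picks are computed,
  unchanged.\<close>

lemma price_picks_run:
  "price_picks al pr t (fst (run (price_policy al pr) R v t)) = run_picks al pr R v t"
proof (induction t)
  case 0
  then show ?case by (simp add: run_picks_def)
next
  case (Suc t)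
  let ?C = "fst (run (price_policy al pr) R v (Suc t))"
  have "price_picks al pr t ?C = price_picks al pr t (fst (run (price_policy al pr) R v t))"
    by (intro price_picks_cong) (simp add: fst_run_Suc del: run.simps)
  then have eq: "price_picks al pr t ?C = run_picks al pr R v t"
    using Suc by simp
  have "run_picks al pr R v (Suc t) =
      (if price_policy al pr t ?C then insert t (run_picks al pr R v t) else run_picks al pr R v t)"
    by (simp add: run_picks_def Let_def split_beta)
  also have "price_policy al pr t ?C \<longleftrightarrow>
      al t (run_picks al pr R v t) \<and> pr t (run_picks al pr R v t) \<le> ?C t"
    by (simp only: price_policy_def eq)
  finally show ?case
    by (simp only: price_picks.simps eq)
qed

lemma run_picks_0 [simp]: "run_picks al pr R v 0 = {}"
  by (simp add: run_picks_def)

lemma run_picks_Suc: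
  "run_picks al pr R v (Suc t) =
    (if al t (run_picks al pr R v t) \<and> pr t (run_picks al pr R v t) \<le> run_obs al pr R v t
     then insert t (run_picks al pr R v t) else run_picks al pr R v t)"
proof -
  let ?C = "fst (run (price_policy al pr) R v (Suc t))"
  have "price_picks al pr t ?C = price_picks al pr t (fst (run (price_policy al pr) R v t))"
    by (intro price_picks_cong) (simp add: fst_run_Suc del: run.simps)
  then have "price_picks al pr t ?C = run_picks al pr R v t"
    by (simp add: price_picks_run)
  moreover have "?C t = run_obs al pr R v t"
    by (rule fst_run) simp
  ultimately show ?thesis
    by (subst price_picks_run[symmetric]) (simp only: price_picks.simps)
qed

lemma run_picks_subset: "run_picks al pr R v t \<subseteq> {..<t}"
  by (induction t) (auto simp: run_picks_Suc)

text \<open>Decisions are irrevocable, so the final set \<open>S\<close> determines every earlier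
  state as \<open>S \<inter> {..<t}\<close>. This lets later estimates be stated for one
  deterministic set.\<close>

lemma run_picks_Int: "t \<le> m \<Longrightarrow> run_picks al pr R v m \<inter> {..<t} = run_picks al pr R v t"
proof (induction m)
  case (Suc m)
  show ?case
  proof (cases "t = Suc m")
    case True
    then show ?thesis using run_picks_subset[of al pr R v "Suc m"] by auto
  next
    case False
    then show ?thesis using Suc by (auto simp: run_picks_Suc)
  qed
qed auto

lemma mem_run_picks:
  assumes "t < m"
  shows "t \<in> run_picks al pr R v m \<longleftrightarrow>
    al t (run_picks al pr R v t) \<and> pr t (run_picks al pr R v t) \<le> run_obs al pr R v t"
proof -
  have "t \<in> run_picks al pr R v m \<longleftrightarrow> t \<in> run_picks al pr R v (Suc t)"
    using run_picks_Int[of "Suc t" m al pr R v] assms by auto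
  then show ?thesis
    using run_picks_subset[of al pr R v t] by (auto simp: run_picks_Suc)
qed

text \<open>The run does not look ahead. In particular, changing \<open>v t\<close> leaves the picks
  before time \<open>t\<close> alone, which is what makes the fresh value independent of the current
  price.\<close>

lemma run_picks_cong:
  "(\<And>s. s < t \<Longrightarrow> v s = w s) \<Longrightarrow> run_picks al pr R v t = run_picks al pr R w t"
proof (induction t)
  case (Suc t)
  then have "run_picks al pr R v t = run_picks al pr R w t" by simp
  moreover have "restrict v {..t} = restrict w {..t}"
    using Suc.prems by (auto simp: fun_eq_iff restrict_def)
  ultimately show ?case
    using Suc.prems by (simp add: run_picks_Suc run_obs_def)
qed simp

lemma run_picks_invariant:
  assumes "P {}"
    and "\<And>t S. t < n \<Longrightarrow> S \<subseteq> {..<t} \<Longrightarrow> P S \<Longrightarrow> al t S \<Longrightarrow> P (insert t S)"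
  shows "t \<le> n \<Longrightarrow> P (run_picks al pr R v t)"
  by (induction t) (use assms run_picks_subset in \<open>auto simp: run_picks_Suc\<close>)

section \<open>The product space of the base values\<close>

text \<open>Outside the index range of the instance the value distributions are unconstrained; a dummy
  point mass there makes the whole family a family of probability spaces.\<close>

definition ext_dist :: "base_instance \<Rightarrow> nat \<Rightarrow> real measure" where
  "ext_dist I t = (if t < n_items I then value_dist I t else return borel 0)"

lemma values_measure_ext: "values_measure I = PiM {..<n_items I} (ext_dist I)"
  unfolding values_measure_def by (intro PiM_cong) (auto simp: ext_dist_def)

lemma sets_ext_dist: "valid_instance I \<Longrightarrow> sets (ext_dist I t) = sets borel"
  by (auto simp: ext_dist_def valid_instance_def)

lemma product_sigma_finite_ext:
  assumes "valid_instance I"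
  shows "product_sigma_finite (ext_dist I)"
proof (rule product_sigma_finite.intro)
  fix t
  have "prob_space (ext_dist I t)"
    using assms by (auto simp: ext_dist_def valid_instance_def intro: prob_space_return)
  then show "sigma_finite_measure (ext_dist I t)"
    by (rule prob_space_imp_sigma_finite)
qed

lemma measurable_value:
  assumes "valid_instance I" "t < n_items I"
  shows "(\<lambda>v. v t) \<in> borel_measurable (values_measure I)"
proof -
  have "(\<lambda>v. v t) \<in> measurable (values_measure I) (ext_dist I t)"
    unfolding values_measure_ext using assms by (intro measurable_component_singleton) auto
  then show ?thesis
    using measurable_cong_sets[OF refl sets_ext_dist[OF assms(1)]] by blast
qed

text \<open>The two claims are intertwined: the observation at \<open>t\<close> depends on the picks
  before \<open>t\<close>, and the next pick set on that observation. The induction runs over the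
  pick sets.\<close>

lemma measurable_run:
  assumes I: "valid_instance I" and R: "valid_adversary I R"
  shows measurable_run_picks: "t \<le> n_items I \<Longrightarrow>
      (\<lambda>v. run_picks al pr R v t) \<in> measurable (values_measure I) (count_space (Pow {..<t}))"
    and measurable_run_obs: "t < n_items I \<Longrightarrow>
      (\<lambda>v. run_obs al pr R v t) \<in> borel_measurable (values_measure I)"
proof -
  let ?M = "values_measure I"
  have obs: "(\<lambda>v. run_obs al pr R v t) \<in> borel_measurable ?M"
    if t: "t < n_items I"
      and X: "(\<lambda>v. run_picks al pr R v t) \<in> measurable ?M (count_space (Pow {..<t}))" for t
  proof -
    have "(\<lambda>v. restrict v {..t}) \<in> measurable ?M (PiM {..t} (ext_dist I))"
      unfolding values_measure_ext using t by (intro measurable_restrict_subset) auto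
    moreover have "sets (PiM {..t} (ext_dist I)) = sets (history_space t)"
      by (intro sets_PiM_cong) (auto simp: sets_ext_dist[OF I])
    ultimately have r: "(\<lambda>v. restrict v {..t}) \<in> measurable ?M (history_space t)"
      using measurable_cong_sets by blast
    have "(\<lambda>v. v t + R t (restrict v {..t}) S) \<in> borel_measurable ?M" if "S \<in> Pow {..<t}" for S
    proof -
      have "(\<lambda>v. R t v S) \<in> borel_measurable (history_space t)"
        using R t that by (auto simp: valid_adversary_def)
      from measurable_compose[OF r this] measurable_value[OF I t] show ?thesis
        by simp
    qed
    from measurable_compose_countable'[OF this X countable_Pow_lessThan]
    show ?thesis unfolding run_obs_def .
  qed
  have picks: "(\<lambda>v. run_picks al pr R v t) \<in> measurable ?M (count_space (Pow {..<t}))"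
    if "t \<le> n_items I" for t
    using that
  proof (induction t)
    case 0
    then show ?case by (simp add: measurable_const)
  next
    case (Suc t)
    then have IH: "(\<lambda>v. run_picks al pr R v t) \<in> measurable ?M (count_space (Pow {..<t}))"
      and t: "t < n_items I" by simp_all
    show ?case
      using measurable_picks_Suc[OF IH measurable_price_step[OF IH obs[OF t IH]]]
      by (simp add: run_picks_Suc)
  qed
  show "t \<le> n_items I \<Longrightarrow>
      (\<lambda>v. run_picks al pr R v t) \<in> measurable (values_measure I) (count_space (Pow {..<t}))"
    by (rule picks)
  show "t < n_items I \<Longrightarrow>
      (\<lambda>v. run_obs al pr R v t) \<in> borel_measurable (values_measure I)"
    using obs picks by simp
qed

lemma AE_values_nonneg:
  assumes "valid_instance I"
  shows "AE v in values_measure I. \<forall>t<n_items I. 0 \<le> v t"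
proof -
  have "AE v in values_measure I. 0 \<le> v t" if "t < n_items I" for t
    unfolding values_measure_def using that assms
    by (intro AE_PiM_component) (auto simp: valid_instance_def)
  then have "AE v in values_measure I. \<forall>t\<in>{..<n_items I}. 0 \<le> v t"
    by (intro AE_finite_allI) auto
  then show ?thesis by (rule eventually_mono) auto
qed

lemma nn_integral_value:
  assumes I: "valid_instance I" and t: "t < n_items I" and f: "f \<in> borel_measurable borel"
  shows "(\<integral>\<^sup>+ v. f (v t) \<partial>values_measure I) = (\<integral>\<^sup>+ x. f x \<partial>value_dist I t)"
proof -
  have "distr (values_measure I) (value_dist I t) (\<lambda>v. v t) = value_dist I t"
    unfolding values_measure_def using I t
    by (intro distr_PiM_component) (auto simp: valid_instance_def)
  then have "(\<integral>\<^sup>+ x. f x \<partial>value_dist I t) =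
      (\<integral>\<^sup>+ x. f x \<partial>distr (values_measure I) (value_dist I t) (\<lambda>v. v t))"
    by simp
  also have "\<dots> = (\<integral>\<^sup>+ v. f (v t) \<partial>values_measure I)"
  proof (rule nn_integral_distr)
    have s: "sets (value_dist I t) = sets borel" using I t by (auto simp: valid_instance_def)
    show "f \<in> borel_measurable (distr (values_measure I) (value_dist I t) (\<lambda>v. v t))"
      using f by (simp add: measurable_cong_sets[OF s refl])
    show "(\<lambda>v. v t) \<in> measurable (values_measure I) (value_dist I t)"
      using measurable_value[OF I t] measurable_cong_sets[OF refl s] by blast
  qed
  finally show ?thesis ..
qed

text \<open>The only use of independence: a quantity that ignores coordinate \<open>t\<close> may be frozen while
  \<open>V\<^sub>t\<close> is averaged.\<close>

lemma nn_integral_fresh_coordinate_ge: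
  assumes I: "valid_instance I" and t: "t < n_items I"
    and f: "case_prod f \<in> borel_measurable (borel \<Otimes>\<^sub>M count_space (Pow {..<t}))"
    and X: "X \<in> measurable (values_measure I) (count_space (Pow {..<t}))"
    and Xt: "\<And>v x. X (v(t := x)) = X v"
    and h: "\<And>S. S \<subseteq> {..<t} \<Longrightarrow> h S \<le> (\<integral>\<^sup>+ x. f x S \<partial>value_dist I t)"
  shows "(\<integral>\<^sup>+ v. h (X v) \<partial>values_measure I) \<le> (\<integral>\<^sup>+ v. f (v t) (X v) \<partial>values_measure I)"
proof -
  interpret product_sigma_finite "ext_dist I" by (rule product_sigma_finite_ext[OF I])
  let ?J = "{..<n_items I} - {t}"
  have J: "insert t ?J = {..<n_items I}" using t by auto
  \<comment> \<open>Tonelli, with coordinate \<open>t\<close> as the inner integral.\<close>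
  have split: "(\<integral>\<^sup>+ v. g v \<partial>values_measure I) =
      (\<integral>\<^sup>+ w. (\<integral>\<^sup>+ x. g (w(t := x)) \<partial>value_dist I t) \<partial>PiM ?J (ext_dist I))"
    if "g \<in> borel_measurable (values_measure I)" for g :: "_ \<Rightarrow> ennreal"
  proof -
    have "ext_dist I t = value_dist I t" using t by (simp add: ext_dist_def)
    then show ?thesis
      using product_nn_integral_insert[of ?J t g, unfolded J] that by (simp only: values_measure_ext) simp
  qed
  have hm: "(\<lambda>v. h (X v)) \<in> borel_measurable (values_measure I)"
    by (rule measurable_compose[OF X]) simp
  have fm: "(\<lambda>v. f (v t) (X v)) \<in> borel_measurable (values_measure I)"
    using measurable_compose[OF measurable_Pair[OF measurable_value[OF I t] X] f] by simp
  interpret D: prob_space "value_dist I t" using I t by (auto simp: valid_instance_def)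
  \<comment> \<open>The bound on \<open>h\<close> is available only for subsets of
    \<open>{..<t}\<close>. To read off the range of \<open>X\<close> at a point lacking coordinate
    \<open>t\<close>, the point is completed by some \<open>x\<close>, which \<open>X\<close>
    ignores.\<close>
  have XP: "X w \<subseteq> {..<t}" if "w \<in> space (PiM ?J (ext_dist I))" for w
  proof -
    obtain x where x: "x \<in> space (value_dist I t)" using D.not_empty by blast
    have "w(t := x) \<in> space (values_measure I)"
      using PiE_fun_upd[of x "\<lambda>i. space (ext_dist I i)" t w ?J] that x t
      unfolding J values_measure_ext space_PiM by (simp add: ext_dist_def)
    then have "X (w(t := x)) \<in> Pow {..<t}"
      using measurable_space[OF X] by simp
    then show ?thesis by (simp add: Xt)
  qed
  show ?thesis
    unfolding split[OF hm] split[OF fm]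
    by (rule nn_integral_mono) (simp add: Xt D.emeasure_space_1 h XP)
qed

section \<open>Revenue and utility of posted prices\<close>

text \<open>The observed value of an accepted item is at least its price and at least its base
  value, hence at least the price plus the positive part of base value minus price. An item rejected
  for its price has no such positive part. Averaging the utility with the price frozen leaves the
  deterministic inequality \<open>path\<close>.\<close>

lemma price_policy_expected_value_ge:
  assumes I: "valid_instance I" and R: "valid_adversary I R"
    and pr: "\<And>t S. pr t S \<ge> 0"
    and vy: "\<And>t p. t < n_items I \<Longrightarrow> p \<ge> 0 \<Longrightarrow>
        ennreal (v t - p * y t) \<le> (\<integral>\<^sup>+ x. ennreal (x - p) \<partial>value_dist I t)"
    and path: "\<And>S. S \<subseteq> {..<n_items I} \<Longrightarrow> (\<And>t. t \<in> S \<Longrightarrow> al t (S \<inter> {..<t})) \<Longrightarrow>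
        ennreal K \<le> (\<Sum>t<n_items I. if al t (S \<inter> {..<t}) then
            ennreal (pr t (S \<inter> {..<t}) * of_bool (t \<in> S))
            + ennreal (v t - pr t (S \<inter> {..<t}) * y t) else 0)"
  shows "ennreal K \<le> expected_value I (price_policy al pr) R"
proof -
  let ?n = "n_items I" and ?M = "values_measure I"
  interpret P: prob_space ?M
    unfolding values_measure_def using I by (intro prob_space_PiM) (auto simp: valid_instance_def)
  define X where "X t w = run_picks al pr R w t" for t w
  \<comment> \<open>\<open>A\<close> is the revenue, \<open>G\<close> the realized utility (a
    positive part, since \<open>ennreal\<close> cuts off at zero), and \<open>H\<close> the lower
    bound on the expected utility at the current price.\<close>
  define A where "A t w = (if al t (X t w) then ennreal (pr t (X t w) * of_bool (t \<in> X ?n w)) else 0)" for t w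
  define G where "G t w = (if al t (X t w) then ennreal (w t - pr t (X t w)) else 0)" for t and w :: "nat \<Rightarrow> real"
  define H where "H t w = (if al t (X t w) then ennreal (v t - pr t (X t w) * y t) else 0)" for t w
  have X: "X t \<in> measurable ?M (count_space (Pow {..<t}))" if "t \<le> ?n" for t
    unfolding X_def[abs_def] using measurable_run_picks[OF I R that] .
  have Am: "A t \<in> borel_measurable ?M" if t: "t < ?n" for t
  proof -
    have "(\<lambda>w. if al t S then ennreal (pr t S * of_bool (t \<in> X ?n w)) else 0) \<in> borel_measurable ?M" for S
      using measurable_compose[OF X[of ?n], of "\<lambda>Q. if al t S then ennreal (pr t S * of_bool (t \<in> Q)) else 0" borel]
      by simp
    from measurable_compose_countable'[OF this X[of t] countable_Pow_lessThan] t show ?thesis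
      unfolding A_def[abs_def] by simp
  qed
  define f where "f t x S = (if al t S then ennreal (x - pr t S) else 0)" for t S and x :: real
  have f: "case_prod (f t) \<in> borel_measurable (borel \<Otimes>\<^sub>M count_space (Pow {..<t}))" for t
  proof -
    have "(\<lambda>x. f t (fst x) S) \<in> borel_measurable (borel \<Otimes>\<^sub>M count_space (Pow {..<t}))" for S
      unfolding f_def by measurable
    from measurable_compose_countable'[OF this measurable_snd countable_Pow_lessThan] show ?thesis
      by (simp add: split_beta)
  qed
  have Gf: "G t w = f t (w t) (X t w)" for t w
    by (simp add: G_def f_def)
  have Gm: "G t \<in> borel_measurable ?M" if t: "t < ?n" for t
    using measurable_compose[OF measurable_Pair[OF measurable_value[OF I t] X[of t]] f[of t]] t
    unfolding Gf[abs_def] by simp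
  have Hm: "H t \<in> borel_measurable ?M" if t: "t < ?n" for t
    using measurable_compose[OF X[of t], of "\<lambda>S. if al t S then ennreal (v t - pr t S * y t) else 0" borel] t
    unfolding H_def[abs_def] by simp
  \<comment> \<open>The price at time \<open>t\<close> is a function of past picks, so
    \<open>vy\<close> applies to it as to a constant.\<close>
  have HG: "(\<integral>\<^sup>+ w. H t w \<partial>?M) \<le> (\<integral>\<^sup>+ w. G t w \<partial>?M)" if t: "t < ?n" for t
    unfolding H_def Gf
  proof (rule nn_integral_fresh_coordinate_ge[OF I t f X])
    show "X t (w(t := x)) = X t w" for w x
      unfolding X_def by (rule run_picks_cong) simp
    show "(if al t S then ennreal (v t - pr t S * y t) else 0) \<le> (\<integral>\<^sup>+ x. f t x S \<partial>value_dist I t)" for S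
      unfolding f_def using vy[OF t pr] by simp
  qed (use t in auto)
  have "ennreal K = (\<integral>\<^sup>+ w. ennreal K \<partial>?M)"
    by (simp add: P.emeasure_space_1)
  also have "\<dots> \<le> (\<integral>\<^sup>+ w. (\<Sum>t<?n. A t w + H t w) \<partial>?M)"
  proof (rule nn_integral_mono)
    fix w
    have eq: "X ?n w \<inter> {..<t} = X t w" if "t < ?n" for t
      unfolding X_def using run_picks_Int that by simp
    have sub: "X ?n w \<subseteq> {..<?n}"
      unfolding X_def by (rule run_picks_subset)
    have "ennreal K \<le> (\<Sum>t<?n. if al t (X ?n w \<inter> {..<t}) then
            ennreal (pr t (X ?n w \<inter> {..<t}) * of_bool (t \<in> X ?n w))
            + ennreal (v t - pr t (X ?n w \<inter> {..<t}) * y t) else 0)"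
    proof (rule path[OF sub])
      fix t assume "t \<in> X ?n w"
      moreover from this sub have "t < ?n" by auto
      ultimately show "al t (X ?n w \<inter> {..<t})"
        using mem_run_picks[of t ?n al pr R w] by (simp add: eq) (simp add: X_def)
    qed
    also have "\<dots> = (\<Sum>t<?n. A t w + H t w)"
      by (intro sum.cong) (auto simp: A_def H_def eq)
    finally show "ennreal K \<le> (\<Sum>t<?n. A t w + H t w)" .
  qed
  also have "\<dots> = (\<Sum>t<?n. (\<integral>\<^sup>+ w. A t w \<partial>?M) + (\<integral>\<^sup>+ w. H t w \<partial>?M))"
    using Am Hm by (subst nn_integral_sum) (auto intro!: sum.cong nn_integral_add)
  also have "\<dots> \<le> (\<Sum>t<?n. (\<integral>\<^sup>+ w. A t w \<partial>?M) + (\<integral>\<^sup>+ w. G t w \<partial>?M))"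
    using HG by (intro sum_mono add_left_mono) auto
  also have "\<dots> = (\<integral>\<^sup>+ w. (\<Sum>t<?n. A t w + G t w) \<partial>?M)"
    using Am Gm by (subst nn_integral_sum) (auto intro!: sum.cong nn_integral_add[symmetric])
  also have "\<dots> \<le> expected_value I (price_policy al pr) R"
    unfolding expected_value_def
  proof (rule nn_integral_mono_AE, rule AE_mp[OF AE_values_nonneg[OF I]], rule AE_I2, rule impI)
    fix w assume "w \<in> space ?M" and w0: "\<forall>t<?n. 0 \<le> w t"
    define c where "c t = run_obs al pr R w t" for t
    have cw: "w t \<le> c t" if "t < ?n" for t
    proof -
      have "(\<lambda>s. if s \<le> t then w s else undefined) \<in> space (history_space t)"
        by (auto simp: space_PiM PiE_def extensional_def)
      moreover have "restrict w {..t} = (\<lambda>s. if s \<le> t then w s else undefined)"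
        by (auto simp: restrict_def)
      ultimately show ?thesis
        using R that run_picks_subset[of al pr R w t]
        by (auto simp: valid_adversary_def c_def run_obs_def)
    qed
    have mem: "t \<in> X ?n w \<longleftrightarrow> al t (X t w) \<and> pr t (X t w) \<le> c t" if "t < ?n" for t
      unfolding X_def c_def using mem_run_picks that by blast
    have "(\<Sum>t<?n. A t w + G t w) \<le> (\<Sum>t<?n. if t \<in> X ?n w then ennreal (c t) else 0)"
    proof (rule sum_mono)
      fix t assume "t \<in> {..<?n}" then have t: "t < ?n" by simp
      show "A t w + G t w \<le> (if t \<in> X ?n w then ennreal (c t) else 0)"
      proof (cases "t \<in> X ?n w")
        case True
        then have a: "al t (X t w)" "pr t (X t w) \<le> c t" using mem[OF t] by auto
        have "A t w + G t w = ennreal (pr t (X t w)) + ennreal (max 0 (w t - pr t (X t w)))"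
          using True a by (auto simp: A_def G_def max_def ennreal_neg)
        also have "\<dots> = ennreal (pr t (X t w) + max 0 (w t - pr t (X t w)))"
          using pr by (subst ennreal_plus) auto
        also have "\<dots> \<le> ennreal (c t)"
          using a cw[OF t] by (intro ennreal_leI) (auto simp: max_def)
        finally show ?thesis using True by simp
      next
        case False
        then have "G t w = 0"
          using mem[OF t] cw[OF t] by (auto simp: G_def ennreal_neg)
        then show ?thesis using False by (simp add: A_def)
      qed
    qed
    also have "\<dots> = (\<Sum>t\<in>X ?n w. ennreal (c t))"
      using run_picks_subset[of al pr R w ?n]
      by (subst sum.inter_restrict[symmetric]) (auto simp: X_def Int_absorb1)
    also have "\<dots> = ennreal (\<Sum>t\<in>X ?n w. c t)"
    proof (rule sum_ennreal)
      fix t assume "t \<in> X ?n w"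
      then have "t < ?n" using run_picks_subset[of al pr R w ?n] by (auto simp: X_def)
      then show "0 \<le> c t" using cw w0 order_trans by blast
    qed
    also have "(\<Sum>t\<in>X ?n w. c t) =
        (\<Sum>t\<in>picked I (price_policy al pr) R w. observed I (price_policy al pr) R w t)"
      unfolding picked_def observed_def X_def c_def run_picks_def[symmetric]
      using run_picks_subset[of al pr R w ?n] by (intro sum.cong) (auto simp: fst_run)
    finally show "(\<Sum>t<?n. A t w + G t w) \<le> ennreal
        (\<Sum>t\<in>picked I (price_policy al pr) R w. observed I (price_policy al pr) R w t)" .
  qed
  finally show ?thesis .
qed

section \<open>The ex-ante relaxation\<close>

text \<open>Since \<open>ennreal\<close> sends negative numbers to zero, this is subadditivity of
  the positive part.\<close>

lemma ennreal_diff_split: "ennreal x \<le> ennreal (x - p) + ennreal p"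
proof (cases "x \<le> p")
  case True
  then show ?thesis using ennreal_leI add_increasing by (metis zero_le)
next
  case False
  then have "ennreal x \<le> ennreal ((x - p) + max 0 p)" by (intro ennreal_leI) auto
  also have "\<dots> = ennreal (x - p) + ennreal (max 0 p)" using False by (intro ennreal_plus) auto
  also have "ennreal (max 0 p) = ennreal p" by (simp add: max_def ennreal_neg)
  finally show ?thesis .
qed

text \<open>The ex-ante relaxation: \<open>y t\<close> is the probability that item \<open>t\<close> belongs to the offline
  optimum and \<open>v t\<close> its expected contribution there.\<close>

lemma ex_ante_relaxation:
  assumes I: "valid_instance I" and B: "0 \<le> budget I" and fin: "opt_base I < \<infinity>"
  obtains v y :: "nat \<Rightarrow> real" where
    "\<And>t. 0 \<le> v t" "\<And>t. 0 \<le> y t" "ennreal (\<Sum>t<n_items I. v t) = opt_base I"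
    "\<And>b \<beta>. (\<And>S. feasible I S \<Longrightarrow> (\<Sum>t\<in>S. b t) \<le> \<beta>) \<Longrightarrow> (\<Sum>t<n_items I. b t * y t) \<le> \<beta>"
    "\<And>t. (\<And>S. feasible I S \<Longrightarrow> t \<notin> S) \<Longrightarrow> v t = 0"
    "\<And>t p. t < n_items I \<Longrightarrow> 0 \<le> p \<Longrightarrow>
        ennreal (v t - p * y t) \<le> (\<integral>\<^sup>+ x. ennreal (x - p) \<partial>value_dist I t)"
proof -
  let ?n = "n_items I" and ?M = "values_measure I"
  interpret P: prob_space ?M
    unfolding values_measure_def using I by (intro prob_space_PiM) (auto simp: valid_instance_def)
  define F where "F = {S. feasible I S}"
  have F: "finite F" "{} \<in> F"
    using B by (auto simp: F_def feasible_def intro: finite_subset[of _ "Pow {..<?n}"])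
  \<comment> \<open>Listing the feasible sets lets ties between optimal sets be broken by the least
    index, which makes the selected optimum \<open>Sel\<close> measurable.\<close>
  then obtain xs where xs: "set xs = F" using finite_list by blast
  define val where "val S w = (\<Sum>t\<in>S. w t)" for S and w :: "nat \<Rightarrow> real"
  define best where "best k w \<longleftrightarrow> k < length xs \<and> (\<forall>S\<in>F. val S w \<le> val (xs ! k) w)" for k w
  define Sel where "Sel w = xs ! (LEAST k. best k w)" for w
  have best: "best (LEAST k. best k w) w" for w
  proof (rule LeastI_ex)
    have "Max ((\<lambda>S. val S w) ` F) \<in> (\<lambda>S. val S w) ` F" using F by (intro Max_in) auto
    then obtain S where S: "S \<in> F" "val S w = Max ((\<lambda>S. val S w) ` F)" by auto
    then obtain k where "k < length xs" "xs ! k = S" using xs by (metis in_set_conv_nth)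
    then show "\<exists>k. best k w" using S F by (auto simp: best_def)
  qed
  have SelF: "Sel w \<in> F" for w
    using best[of w] xs by (auto simp: best_def Sel_def)
  then have Seln: "Sel w \<subseteq> {..<?n}" for w
    by (auto simp: F_def feasible_def)
  have SelMax: "Max {\<Sum>t\<in>S. w t |S. feasible I S} = val (Sel w) w"
    for w :: "nat \<Rightarrow> real"
  proof -
    have "{\<Sum>t\<in>S. w t |S. feasible I S} = (\<lambda>S. val S w) ` F" by (auto simp: F_def val_def)
    then show ?thesis
      using best[of w] SelF F by (auto simp: best_def Sel_def intro!: Max_eqI)
  qed
  have val_m: "val S \<in> borel_measurable ?M" if "S \<in> F" for S
    unfolding val_def[abs_def] using that
    by (intro borel_measurable_sum measurable_value[OF I]) (auto simp: F_def feasible_def)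
  have "Measurable.pred ?M (best k)" for k
  proof (cases "k < length xs")
    case True
    then have "xs ! k \<in> F" using xs by auto
    then have "Measurable.pred ?M (\<lambda>w. val S w \<le> val (xs ! k) w)" if "S \<in> F" for S
      unfolding pred_def using val_m that by (intro borel_measurable_le) auto
    then have "Measurable.pred ?M (\<lambda>w. \<forall>S\<in>F. val S w \<le> val (xs ! k) w)"
      using F by (intro pred_intros_finite) auto
    then show ?thesis using True by (simp add: best_def[abs_def])
  next
    case False
    then show ?thesis by (simp add: best_def[abs_def])
  qed
  then have N: "(\<lambda>w. LEAST k. best k w) \<in> measurable ?M (count_space UNIV)"
    by (rule measurable_Least)
  have Selm: "Measurable.pred ?M (\<lambda>w. t \<in> Sel w)" for t
    unfolding Sel_def using measurable_compose[OF N, of "\<lambda>k. t \<in> xs ! k" "count_space UNIV"] by simp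
  have ofm: "(\<lambda>w. of_bool (t \<in> Sel w) :: real) \<in> borel_measurable ?M" for t
    using measurable_compose[OF Selm, of "of_bool" borel t] by simp
  have int: "integrable ?M (\<lambda>w. of_bool (t \<in> Sel w) :: real)" for t
    using ofm by (intro P.integrable_const_bound[of _ 1]) auto
  define y :: "nat \<Rightarrow> real" where "y t = (LINT w|?M. of_bool (t \<in> Sel w))" for t
  define V where "V t = (\<integral>\<^sup>+ w. (if t \<in> Sel w then ennreal (w t) else 0) \<partial>?M)" for t
  define v where "v t = enn2real (V t)" for t
  have Vm: "(\<lambda>w. if t \<in> Sel w then ennreal (w t) else 0) \<in> borel_measurable ?M" if "t < ?n" for t
    using Selm[of t] measurable_value[OF I that] by measurable
  have "opt_base I = (\<integral>\<^sup>+ w. (\<Sum>t<?n. if t \<in> Sel w then ennreal (w t) else 0) \<partial>?M)"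
    unfolding opt_base_def SelMax
  proof (rule nn_integral_cong_AE, rule AE_mp[OF AE_values_nonneg[OF I]], rule AE_I2, rule impI)
    fix w :: "nat \<Rightarrow> real" assume "\<forall>t<?n. 0 \<le> w t"
    then have "ennreal (val (Sel w) w) = (\<Sum>t\<in>Sel w. ennreal (w t))"
      unfolding val_def using Seln[of w] by (intro sum_ennreal[symmetric]) auto
    also have "\<dots> = (\<Sum>t<?n. if t \<in> Sel w then ennreal (w t) else 0)"
      using Seln[of w] by (subst sum.inter_restrict[symmetric]) (auto simp: Int_absorb1)
    finally show "ennreal (val (Sel w) w) = (\<Sum>t<?n. if t \<in> Sel w then ennreal (w t) else 0)" .
  qed
  also have "\<dots> = (\<Sum>t<?n. V t)"
    unfolding V_def using Vm by (intro nn_integral_sum) auto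
  finally have opt: "opt_base I = (\<Sum>t<?n. V t)" .
  \<comment> \<open>Finiteness of the optimum enters here: it bounds each contribution, which is
    therefore a real number.\<close>
  have Vv: "V t = ennreal (v t)" if "t < ?n" for t
  proof -
    have "V t \<le> opt_base I" unfolding opt using that by (intro member_le_sum) auto
    then show ?thesis using fin unfolding v_def by (intro ennreal_enn2real[symmetric]) auto
  qed
  have y0: "0 \<le> y t" for t unfolding y_def by (rule Bochner_Integration.integral_nonneg) simp
  show thesis
  proof (rule that[of v y])
    show "0 \<le> v t" for t by (simp add: v_def)
    show "0 \<le> y t" for t by (rule y0)
    show "ennreal (\<Sum>t<?n. v t) = opt_base I"
    proof -
      have "ennreal (\<Sum>t<?n. v t) = (\<Sum>t<?n. ennreal (v t))"
        by (intro sum_ennreal[symmetric]) (simp add: v_def)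
      then show ?thesis unfolding opt using Vv by simp
    qed
    \<comment> \<open>\<open>y\<close> is an average of indicator vectors of feasible sets and
      inherits every linear inequality valid for all of them.\<close>
    show "(\<Sum>t<?n. b t * y t) \<le> \<beta>" if b: "\<And>S. feasible I S \<Longrightarrow> (\<Sum>t\<in>S. b t) \<le> \<beta>" for b \<beta>
    proof -
      have int': "integrable ?M (\<lambda>w. b t * of_bool (t \<in> Sel w))" for t
        using int by (rule integrable_mult_right)
      have "(\<Sum>t<?n. b t * y t) = (\<Sum>t<?n. LINT w|?M. b t * of_bool (t \<in> Sel w))"
        by (simp add: y_def)
      also have "\<dots> = (LINT w|?M. (\<Sum>t<?n. b t * of_bool (t \<in> Sel w)))"
        by (rule Bochner_Integration.integral_sum[symmetric]) (rule int')
      also have "\<dots> \<le> \<beta>"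
      proof (rule P.integral_le_const)
        show "AE w in (values_measure I). (\<Sum>t<?n. b t * of_bool (t \<in> Sel w)) \<le> \<beta>"
        proof (rule AE_I2)
          fix w
          have "(\<Sum>t<?n. b t * of_bool (t \<in> Sel w)) = (\<Sum>t<?n. if t \<in> Sel w then b t else 0)"
            by (intro sum.cong) auto
          also have "\<dots> = (\<Sum>t\<in>Sel w. b t)"
            using Seln[of w] by (subst sum.inter_restrict[symmetric]) (auto simp: Int_absorb1)
          finally show "(\<Sum>t<?n. b t * of_bool (t \<in> Sel w)) \<le> \<beta>"
            using b[of "Sel w"] SelF[of w] by (simp add: F_def)
        qed
      qed (intro Bochner_Integration.integrable_sum int')
      finally show ?thesis .
    qed
    show "v t = 0" if "\<And>S. feasible I S \<Longrightarrow> t \<notin> S" for t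
    proof -
      have "t \<notin> Sel w" for w using that SelF[of w] by (simp add: F_def)
      then show ?thesis by (simp add: v_def V_def)
    qed
    show "ennreal (v t - p * y t) \<le> (\<integral>\<^sup>+ x. ennreal (x - p) \<partial>value_dist I t)"
      if t: "t < ?n" and p: "0 \<le> p" for t p
    proof -
      let ?g = "\<integral>\<^sup>+ x. ennreal (x - p) \<partial>value_dist I t"
      \<comment> \<open>Pointwise, what the item contributes to the optimum is at most its excess
        over \<open>p\<close>, plus \<open>p\<close> if it is selected; averaging turns the
        indicator into \<open>y t\<close>.\<close>
      have "ennreal (v t) \<le> (\<integral>\<^sup>+ w. ennreal (w t - p) + ennreal p * ennreal (of_bool (t \<in> Sel w)) \<partial>?M)"
        unfolding Vv[OF t, symmetric] V_def
      proof (rule nn_integral_mono)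
        show "(if t \<in> Sel w then ennreal (w t) else 0) \<le>
            ennreal (w t - p) + ennreal p * ennreal (of_bool (t \<in> Sel w))" for w
          using ennreal_diff_split[of "w t" p] by simp
      qed
      also have "\<dots> = (\<integral>\<^sup>+ w. ennreal (w t - p) \<partial>?M)
          + ennreal p * (\<integral>\<^sup>+ w. ennreal (of_bool (t \<in> Sel w)) \<partial>?M)"
        using measurable_value[OF I t] ofm[of t]
        by (simp add: nn_integral_add nn_integral_cmult)
      also have "(\<integral>\<^sup>+ w. ennreal (w t - p) \<partial>?M) = ?g"
        by (rule nn_integral_value[OF I t]) simp
      also have "(\<integral>\<^sup>+ w. ennreal (of_bool (t \<in> Sel w)) \<partial>?M) = ennreal (y t)"
        unfolding y_def using int by (intro nn_integral_eq_integral) auto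
      also have "ennreal p * ennreal (y t) = ennreal (p * y t)"
        using p by (simp add: ennreal_mult')
      finally have "ennreal (v t) - ennreal (p * y t) \<le> ?g"
        by (simp add: ennreal_minus_le_iff add.commute)
      then show ?thesis
        using p by (simp add: ennreal_minus y0)
    qed
  qed
qed

section \<open>Multiplicative weights\<close>

definition mw_weight :: "real \<Rightarrow> (nat \<Rightarrow> nat \<Rightarrow> real) \<Rightarrow> nat \<Rightarrow> nat \<Rightarrow> real" where
  "mw_weight \<epsilon> g t i = (\<Prod>s<t. 1 + \<epsilon> * g s i)"

text \<open>The summand \<open>1\<close> in the denominator is the weight of an additional expert whose gain is
  always zero; it keeps the regret bound meaningful when all real experts lose.\<close>

definition mw_prob :: "real \<Rightarrow> nat \<Rightarrow> (nat \<Rightarrow> nat \<Rightarrow> real) \<Rightarrow> nat \<Rightarrow> nat \<Rightarrow> real" where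
  "mw_prob \<epsilon> d g t i = mw_weight \<epsilon> g t i / (1 + (\<Sum>j<d. mw_weight \<epsilon> g t j))"

text \<open>Weights at time \<open>t\<close> use only earlier gains, so prices built from them are
  functions of past picks.\<close>

lemma mw_prob_cong:
  assumes "\<And>s i. s < t \<Longrightarrow> g s i = g' s i"
  shows "mw_prob \<epsilon> d g t i = mw_prob \<epsilon> d g' t i"
  using assms by (simp add: mw_prob_def mw_weight_def)

lemma mw_factor_ge:
  fixes x \<epsilon> :: real
  assumes "0 < \<epsilon>" "\<epsilon> \<le> 1/2" "\<bar>x\<bar> \<le> 1"
  shows "1/2 \<le> 1 + \<epsilon> * x"
proof -
  have "\<bar>\<epsilon> * x\<bar> \<le> (1/2) * 1" unfolding abs_mult using assms by (intro mult_mono) auto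
  then show ?thesis by linarith
qed

lemma mw_weight_pos:
  assumes "0 < \<epsilon>" "\<epsilon> \<le> 1/2" "\<And>s. s < t \<Longrightarrow> \<bar>g s i\<bar> \<le> 1"
  shows "0 < mw_weight \<epsilon> g t i"
  unfolding mw_weight_def
proof (intro prod_pos ballI)
  fix s assume "s \<in> {..<t}"
  then have "1/2 \<le> 1 + \<epsilon> * g s i" using mw_factor_ge[OF assms(1,2)] assms(3) by simp
  then show "0 < 1 + \<epsilon> * g s i" by linarith
qed

lemma mw_prob_nonneg:
  assumes "0 < \<epsilon>" "\<epsilon> \<le> 1/2" "\<And>s j. s < t \<Longrightarrow> j < d \<Longrightarrow> \<bar>g s j\<bar> \<le> 1" "i < d"
  shows "0 \<le> mw_prob \<epsilon> d g t i"
  unfolding mw_prob_def using mw_weight_pos[OF assms(1,2), of t g] assms(3,4)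
  by (intro divide_nonneg_nonneg add_nonneg_nonneg sum_nonneg) (auto intro!: less_imp_le)

text \<open>One round multiplies the total weight, zero-gain expert included, by one plus
  \<open>\<epsilon>\<close> times the expected gain of the round, and
  \<open>1 + x \<le> exp x\<close>. The initial total is \<open>1 + real d\<close>.\<close>

lemma mw_potential:
  assumes \<epsilon>: "0 < \<epsilon>" "\<epsilon> \<le> 1/2"
    and g: "\<And>s i. s < m \<Longrightarrow> i < d \<Longrightarrow> \<bar>g s i\<bar> \<le> 1"
  shows "1 + (\<Sum>i<d. mw_weight \<epsilon> g m i) \<le>
    (1 + real d) * exp (\<epsilon> * (\<Sum>t<m. \<Sum>i<d. mw_prob \<epsilon> d g t i * g t i))"
  using g
proof (induction m)
  case 0
  then show ?case by (simp add: mw_weight_def)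
next
  case (Suc m)
  define W where "W = 1 + (\<Sum>i<d. mw_weight \<epsilon> g m i)"
  have "0 \<le> (\<Sum>i<d. mw_weight \<epsilon> g m i)"
    using mw_weight_pos[OF \<epsilon>, of m g] Suc.prems by (intro sum_nonneg) (auto intro!: less_imp_le)
  then have W: "W > 0" by (simp add: W_def)
  define G where "G = (\<Sum>i<d. mw_prob \<epsilon> d g m i * g m i)"
  have WG: "W * G = (\<Sum>i<d. mw_weight \<epsilon> g m i * g m i)"
    unfolding G_def mw_prob_def W_def[symmetric] sum_distrib_left using W by (intro sum.cong) auto
  have "1 + (\<Sum>i<d. mw_weight \<epsilon> g (Suc m) i) = W + \<epsilon> * (\<Sum>i<d. mw_weight \<epsilon> g m i * g m i)"
    by (simp add: W_def mw_weight_def sum_distrib_left algebra_simps sum.distrib)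
  also have "\<dots> = W * (1 + \<epsilon> * G)"
    unfolding WG[symmetric] by (simp add: algebra_simps)
  also have "\<dots> \<le> W * exp (\<epsilon> * G)"
    using W exp_ge_add_one_self by (intro mult_left_mono) auto
  also have "\<dots> \<le> ((1 + real d) * exp (\<epsilon> * (\<Sum>t<m. \<Sum>i<d. mw_prob \<epsilon> d g t i * g t i))) * exp (\<epsilon> * G)"
    using Suc unfolding W_def by (intro mult_right_mono) auto
  also have "\<dots> = (1 + real d) * exp (\<epsilon> * (\<Sum>t<Suc m. \<Sum>i<d. mw_prob \<epsilon> d g t i * g t i))"
    by (simp add: G_def exp_add[symmetric] algebra_simps)
  finally show ?case .
qed

text \<open>The total weight dominates each single weight. Logarithms turn the comparison with the
  zero-gain expert, whose weight stays one, into the first bound, and that with expert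
  \<open>i\<close> into the second.\<close>

lemma mw_regret:
  assumes \<epsilon>: "0 < \<epsilon>" "\<epsilon> \<le> 1/2"
    and g: "\<And>s i. s < m \<Longrightarrow> i < d \<Longrightarrow> \<bar>g s i\<bar> \<le> 1"
  defines "G \<equiv> \<Sum>t<m. \<Sum>i<d. mw_prob \<epsilon> d g t i * g t i"
  shows "- ln (1 + real d) / \<epsilon> \<le> G"
    and "i < d \<Longrightarrow> (\<Sum>t<m. g t i - 2 * \<epsilon> * (g t i)\<^sup>2) - ln (1 + real d) / \<epsilon> \<le> G"
proof -
  have pot: "1 + (\<Sum>i<d. mw_weight \<epsilon> g m i) \<le> (1 + real d) * exp (\<epsilon> * G)"
    unfolding G_def by (rule mw_potential[OF \<epsilon> g])
  have ln_rhs: "ln ((1 + real d) * exp (\<epsilon> * G)) = ln (1 + real d) + \<epsilon> * G"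
    by (simp add: ln_mult)
  have wpos: "0 < mw_weight \<epsilon> g m i" if "i < d" for i
    using mw_weight_pos[OF \<epsilon>, of m g i] g that by auto
  then have snn: "0 \<le> (\<Sum>i<d. mw_weight \<epsilon> g m i)"
    by (intro sum_nonneg) (auto intro!: less_imp_le)
  then have "1 \<le> (1 + real d) * exp (\<epsilon> * G)" using pot by linarith
  then have "0 \<le> ln ((1 + real d) * exp (\<epsilon> * G))" by simp
  then show "- ln (1 + real d) / \<epsilon> \<le> G"
    using \<epsilon> unfolding ln_rhs by (simp add: field_simps)
  show "(\<Sum>t<m. g t i - 2 * \<epsilon> * (g t i)\<^sup>2) - ln (1 + real d) / \<epsilon> \<le> G" if i: "i < d"
  proof -
    \<comment> \<open>The squared gain is kept instead of being replaced by one: it will be charged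
      to the load, so the error does not grow with the number of rounds.\<close>
    have fac: "\<epsilon> * (g t i - 2 * \<epsilon> * (g t i)\<^sup>2) \<le> ln (1 + \<epsilon> * g t i)" if "t < m" for t
    proof -
      have "\<bar>\<epsilon> * g t i\<bar> \<le> (1/2) * 1"
        unfolding abs_mult using \<epsilon> g[OF that i] by (intro mult_mono) auto
      then have "\<bar>ln (1 + \<epsilon> * g t i) - \<epsilon> * g t i\<bar> \<le> 2 * (\<epsilon> * g t i)\<^sup>2"
        by (intro abs_ln_one_plus_x_minus_x_bound) auto
      then show ?thesis by (simp add: power2_eq_square algebra_simps)
    qed
    have "\<epsilon> * (\<Sum>t<m. g t i - 2 * \<epsilon> * (g t i)\<^sup>2) \<le> (\<Sum>t<m. ln (1 + \<epsilon> * g t i))"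
      unfolding sum_distrib_left using fac by (intro sum_mono) auto
    also have "\<dots> = ln (mw_weight \<epsilon> g m i)"
    proof -
      have "1 + \<epsilon> * g t i \<noteq> 0" if "t < m" for t
        using mw_factor_ge[OF \<epsilon> g[OF that i]] by linarith
      then show ?thesis unfolding mw_weight_def by (intro ln_prod[symmetric]) auto
    qed
    also have "\<dots> \<le> ln ((1 + real d) * exp (\<epsilon> * G))"
    proof -
      have "mw_weight \<epsilon> g m i \<le> (\<Sum>i<d. mw_weight \<epsilon> g m i)"
        using i wpos by (intro member_le_sum) (auto intro: less_imp_le)
      then have "mw_weight \<epsilon> g m i \<le> (1 + real d) * exp (\<epsilon> * G)" using pot by linarith
      then show ?thesis using wpos[OF i] by simp
    qed
    finally have "\<epsilon> * (\<Sum>t<m. g t i - 2 * \<epsilon> * (g t i)\<^sup>2) \<le> ln (1 + real d) + \<epsilon> * G"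
      unfolding ln_rhs .
    then show ?thesis using \<epsilon> by (simp add: field_simps)
  qed
qed

section \<open>Policies with a stopping rule\<close>

definition stopping_policy ::
  "nat set \<Rightarrow> (nat set \<Rightarrow> bool) \<Rightarrow> (nat \<Rightarrow> nat set \<Rightarrow> real) \<Rightarrow> policy" where
  "stopping_policy T stop pr = price_policy (\<lambda>t S. t \<in> T \<and> \<not> stop S) pr"

text \<open>The value \<open>K\<close> is certified either at the first stop, by revenue net of
  ex-ante cost alone, or at the end, with the ex-ante values added. Only an initial segment on which
  the policy is active has to be analysed.\<close>

lemma stopping_policy_expected_value_ge:
  assumes I: "valid_instance I" and R: "valid_adversary I R"
    and pr: "\<And>t S. pr t S \<ge> 0" and v0: "\<And>t. v t \<ge> 0"
    and T: "\<And>t. t \<notin> T \<Longrightarrow> v t = 0 \<and> y t = 0"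
    and vy: "\<And>t p. t < n_items I \<Longrightarrow> p \<ge> 0 \<Longrightarrow>
        ennreal (v t - p * y t) \<le> (\<integral>\<^sup>+ x. ennreal (x - p) \<partial>value_dist I t)"
    and stopped: "\<And>S m. S \<subseteq> {..<n_items I} \<Longrightarrow> m \<le> n_items I \<Longrightarrow> stop (S \<inter> {..<m}) \<Longrightarrow>
        K \<le> (\<Sum>t<m. pr t (S \<inter> {..<t}) * (of_bool (t \<in> S) - y t))"
    and not_stopped: "\<And>S. S \<subseteq> {..<n_items I} \<Longrightarrow>
        K \<le> (\<Sum>t<n_items I. v t + pr t (S \<inter> {..<t}) * (of_bool (t \<in> S) - y t))"
  shows "ennreal K \<le> expected_value I (stopping_policy T stop pr) R"
  unfolding stopping_policy_def
proof (rule price_policy_expected_value_ge[OF I R pr vy])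
  fix S assume S: "S \<subseteq> {..<n_items I}" and al: "\<And>t. t \<in> S \<Longrightarrow> t \<in> T \<and> \<not> stop (S \<inter> {..<t})"
  let ?n = "n_items I"
  let ?P = "\<lambda>m. m = ?n \<or> stop (S \<inter> {..<m})"
  \<comment> \<open>The first stopping time, with the horizon as default.\<close>
  define m where "m = (LEAST m. ?P m)"
  have Pm: "?P m" unfolding m_def by (rule LeastI[of ?P ?n]) simp
  have mn: "m \<le> ?n" unfolding m_def by (rule Least_le) simp
  have before: "\<not> stop (S \<inter> {..<t})" if "t < m" for t
    using not_less_Least[of t ?P] that by (auto simp: m_def)
  let ?p = "\<lambda>t. pr t (S \<inter> {..<t})"
  let ?f = "\<lambda>t. if t \<in> T \<and> \<not> stop (S \<inter> {..<t}) then
      ennreal (?p t * of_bool (t \<in> S)) + ennreal (v t - ?p t * y t) else 0"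
  have "K \<le> (\<Sum>t<m. v t + ?p t * (of_bool (t \<in> S) - y t))"
  proof (cases "m = ?n")
    case True
    then show ?thesis using not_stopped[OF S] by simp
  next
    case False
    then have "K \<le> (\<Sum>t<m. ?p t * (of_bool (t \<in> S) - y t))"
      using stopped[OF S mn] Pm by simp
    also have "\<dots> \<le> (\<Sum>t<m. v t + ?p t * (of_bool (t \<in> S) - y t))"
      by (intro sum_mono) (simp add: v0)
    finally show ?thesis .
  qed
  \<comment> \<open>Inside \<open>T\<close>, cutting the utility off at zero only increases it;
    outside, \<open>v t\<close>, \<open>y t\<close> and the indicator of a pick all vanish.\<close>
  also have "\<dots> \<le> (\<Sum>t<m. if t \<in> T then ?p t * of_bool (t \<in> S) + max 0 (v t - ?p t * y t) else 0)"
  proof (rule sum_mono)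
    fix t
    have "v t + ?p t * (of_bool (t \<in> S) - y t) = ?p t * of_bool (t \<in> S) + (v t - ?p t * y t)"
      by (simp add: algebra_simps)
    moreover have "v t = 0 \<and> y t = 0 \<and> t \<notin> S" if "t \<notin> T" using T al that by blast
    ultimately show "v t + ?p t * (of_bool (t \<in> S) - y t) \<le>
        (if t \<in> T then ?p t * of_bool (t \<in> S) + max 0 (v t - ?p t * y t) else 0)"
      by simp
  qed
  finally have "ennreal K \<le> ennreal \<dots>" by (rule ennreal_leI)
  also have "\<dots> = (\<Sum>t<m. ennreal (if t \<in> T then ?p t * of_bool (t \<in> S) + max 0 (v t - ?p t * y t) else 0))"
    using pr by (intro sum_ennreal[symmetric]) auto
  also have "\<dots> = (\<Sum>t<m. ?f t)"
  proof (rule sum.cong)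
    fix t assume "t \<in> {..<m}"
    moreover have "ennreal (max 0 x) = ennreal x" for x :: real
      by (simp add: max_def ennreal_neg)
    ultimately show "ennreal (if t \<in> T then ?p t * of_bool (t \<in> S) + max 0 (v t - ?p t * y t) else 0) = ?f t"
      using pr before by (simp add: ennreal_plus del: ennreal_max_0)
  qed simp
  \<comment> \<open>Terms from \<open>m\<close> on are nonnegative in \<open>ennreal\<close>, even
    if the rule permits purchases again.\<close>
  also have "\<dots> \<le> (\<Sum>t<?n. ?f t)"
    using mn by (intro sum_mono2) auto
  finally show "ennreal K \<le> (\<Sum>t<?n. ?f t)" .
qed

definition competitive_policy :: "base_instance \<Rightarrow> real \<Rightarrow> policy \<Rightarrow> bool" where
  "competitive_policy I c P \<longleftrightarrow> measurable_policy I P \<and>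
     (\<forall>R. valid_adversary I R \<longrightarrow>
        (\<forall>v. (\<forall>t<n_items I. 0 \<le> v t) \<longrightarrow> feasible I (picked I P R v)) \<and>
        expected_value I P R \<ge> ennreal c * opt_base I)"

lemma competitive_stopping_policy:
  assumes B: "0 \<le> budget I"
    and feas: "\<And>t S. t < n_items I \<Longrightarrow> S \<subseteq> {..<t} \<Longrightarrow> feasible I S \<Longrightarrow> S \<subseteq> T \<Longrightarrow> t \<in> T \<Longrightarrow>
      \<not> stop S \<Longrightarrow> feasible I (insert t S)"
    and val: "\<And>R. valid_adversary I R \<Longrightarrow>
      ennreal c * opt_base I \<le> expected_value I (stopping_policy T stop pr) R"
  shows "competitive_policy I c (stopping_policy T stop pr)"
proof -
  have "feasible I (picked I (stopping_policy T stop pr) R v)" for R v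
  proof -
    let ?al = "\<lambda>t S. t \<in> T \<and> \<not> stop S"
    have "feasible I (run_picks ?al pr R v (n_items I)) \<and> run_picks ?al pr R v (n_items I) \<subseteq> T"
      by (rule run_picks_invariant[where n = "n_items I"])
        (use B feas in \<open>auto simp: feasible_def[of I "{}"]\<close>)
    then show ?thesis
      by (simp add: picked_def stopping_policy_def run_picks_def)
  qed
  moreover have "measurable_policy I (stopping_policy T stop pr)"
    unfolding stopping_policy_def by (rule measurable_price_policy)
  ultimately show ?thesis
    using val by (simp add: competitive_policy_def)
qed

text \<open>The optimum is at most the total value of the items that fit on their own, so one of
  these has infinite mean. Selling to it alone at price zero earns an infinite expectation, which
  suits every \<open>c\<close>.\<close>

lemma infinite_opt_policy:
  assumes I: "valid_instance I" and B: "0 \<le> budget I" and inf: "opt_base I = \<infinity>"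
  shows "\<exists>P. competitive_policy I c P"
proof -
  let ?n = "n_items I" and ?M = "values_measure I"
  let ?E = "\<lambda>t. \<integral>\<^sup>+ x. ennreal x \<partial>value_dist I t"
  have "\<exists>t<?n. feasible I {t} \<and> ?E t = \<infinity>"
  proof (rule ccontr)
    assume H: "\<not> ?thesis"
    define Q where "Q = {t. t < ?n \<and> feasible I {t}}"
    have Q: "finite Q" by (simp add: Q_def)
    have "opt_base I \<le> (\<integral>\<^sup>+ v. (\<Sum>t\<in>Q. ennreal (v t)) \<partial>?M)"
      unfolding opt_base_def
    proof (rule nn_integral_mono_AE, rule AE_mp[OF AE_values_nonneg[OF I]], rule AE_I2, rule impI)
      fix v :: "nat \<Rightarrow> real" assume v: "\<forall>t<?n. 0 \<le> v t"
      let ?X = "{\<Sum>t\<in>S. v t |S. feasible I S}"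
      have "{S. feasible I S} \<subseteq> Pow {..<?n}" by (auto simp: feasible_def)
      then have "finite {S. feasible I S}" by (rule finite_subset) simp
      then have fX: "finite ?X" by simp
      moreover have "feasible I {}" using B by (simp add: feasible_def)
      then have "?X \<noteq> {}" by blast
      ultimately have "Max ?X \<in> ?X" by (rule Max_in)
      then obtain S where S: "feasible I S" "Max ?X = (\<Sum>t\<in>S. v t)" by blast
      have Sn: "S \<subseteq> {..<?n}" using S by (simp add: feasible_def)
      have "S \<subseteq> Q"
      proof
        fix t assume t: "t \<in> S"
        have "(\<Sum>s\<in>{t}. item_size I s i) \<le> budget I" if i: "i < n_dims I" for i
        proof -
          have "(\<Sum>s\<in>{t}. item_size I s i) \<le> (\<Sum>s\<in>S. item_size I s i)"
            using I Sn t i finite_subset[OF Sn]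
            by (intro sum_mono2) (auto simp: valid_instance_def subset_eq)
          then show ?thesis using S i by (force simp: feasible_def)
        qed
        then show "t \<in> Q" using t Sn by (auto simp: Q_def feasible_def)
      qed
      then have "(\<Sum>t\<in>S. v t) \<le> (\<Sum>t\<in>Q. v t)"
        using v Q by (intro sum_mono2) (auto simp: Q_def)
      then have "ennreal (Max ?X) \<le> ennreal (\<Sum>t\<in>Q. v t)" using S by (simp add: ennreal_leI)
      also have "\<dots> = (\<Sum>t\<in>Q. ennreal (v t))"
        using v by (intro sum_ennreal[symmetric]) (auto simp: Q_def)
      finally show "ennreal (Max ?X) \<le> (\<Sum>t\<in>Q. ennreal (v t))" .
    qed
    also have "\<dots> = (\<Sum>t\<in>Q. (\<integral>\<^sup>+ v. ennreal (v t) \<partial>?M))"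
      using measurable_value[OF I] by (intro nn_integral_sum) (auto simp: Q_def)
    also have "\<dots> = (\<Sum>t\<in>Q. ?E t)"
      by (intro sum.cong nn_integral_value[OF I]) (auto simp: Q_def)
    also have "\<dots> < \<infinity>"
      using H Q by (auto simp: ennreal_sum_less_top less_top Q_def)
    finally show False using inf by simp
  qed
  then obtain t0 where t0: "t0 < ?n" "feasible I {t0}" "?E t0 = \<infinity>" by blast
  have "expected_value I (stopping_policy {t0} (\<lambda>S. False) (\<lambda>_ _. 0)) R = \<infinity>"
    if R: "valid_adversary I R" for R
  proof (rule ccontr)
    assume "\<not> ?thesis"
    then obtain K0 where K0: "0 \<le> K0"
        "expected_value I (stopping_policy {t0} (\<lambda>S. False) (\<lambda>_ _. 0)) R = ennreal K0"
      by (metis ennreal_cases infinity_ennreal_def)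
    \<comment> \<open>The expected excess of the item over any price is infinite, so it may be
      assigned an arbitrary ex-ante value with \<open>y = 0\<close>; \<open>K0 + 1\<close>
      contradicts the supposed value \<open>K0\<close>.\<close>
    have "ennreal (K0 + 1) \<le> expected_value I (stopping_policy {t0} (\<lambda>S. False) (\<lambda>_ _. 0)) R"
    proof (rule stopping_policy_expected_value_ge[OF I R,
          where v = "\<lambda>t. if t = t0 then K0 + 1 else 0" and y = "\<lambda>_. 0"])
      show "ennreal ((if t = t0 then K0 + 1 else 0) - p * 0) \<le> (\<integral>\<^sup>+ x. ennreal (x - p) \<partial>value_dist I t)"
        if t: "t < ?n" and p: "0 \<le> p" for t p
      proof (cases "t = t0")
        case True
        interpret D: prob_space "value_dist I t" using I t by (auto simp: valid_instance_def)
        have [measurable_cong]: "sets (value_dist I t) = sets borel"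
          using I t by (auto simp: valid_instance_def)
        have "?E t \<le> (\<integral>\<^sup>+ x. ennreal (x - p) + ennreal p \<partial>value_dist I t)"
          by (intro nn_integral_mono ennreal_diff_split)
        also have "\<dots> = (\<integral>\<^sup>+ x. ennreal (x - p) \<partial>value_dist I t) + ennreal p"
          by (subst nn_integral_add) (auto simp: D.emeasure_space_1)
        finally have "(\<integral>\<^sup>+ x. ennreal (x - p) \<partial>value_dist I t) = \<infinity>"
          using t0 True by (simp add: top_unique)
        then show ?thesis by simp
      qed simp
      show "K0 + 1 \<le> (\<Sum>t<?n. (if t = t0 then K0 + 1 else 0) + 0 * (of_bool (t \<in> S) - 0))" for S
        using t0 by simp
    qed (use K0 in auto)
    then show False using K0 by simp
  qed
  then have "competitive_policy I c (stopping_policy {t0} (\<lambda>S. False) (\<lambda>_ _. 0))"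
    using t0 by (intro competitive_stopping_policy[OF B]) (auto simp: subset_singleton_iff)
  then show ?thesis by blast
qed

section \<open>Static prices per unit of load\<close>

lemma ennreal_scale_le: "0 \<le> \<sigma> \<Longrightarrow> \<sigma> \<le> 1 \<Longrightarrow> ennreal (\<sigma> * x) \<le> ennreal x"
  by (cases "0 \<le> x") (auto simp: ennreal_neg mult_nonneg_nonpos intro!: ennreal_leI mult_left_le_one_le)

lemma sum_Int_lessThan:
  fixes f :: "nat \<Rightarrow> real"
  shows "(\<Sum>t\<in>S \<inter> {..<m}. f t) = (\<Sum>t<m. f t * of_bool (t \<in> S))"
proof -
  have "(\<Sum>t\<in>{..<m} \<inter> S. f t) = (\<Sum>t<m. if t \<in> S then f t else 0)"
    by (rule sum.inter_restrict) simp
  also have "\<dots> = (\<Sum>t<m. f t * of_bool (t \<in> S))"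
    by (rule sum.cong) auto
  finally show ?thesis by (simp add: Int_commute)
qed

text \<open>Scaling the ex-ante data by \<open>1/4\<close> leaves value \<open>V / 4\<close> and
  load at most \<open>\<beta> / 2\<close>. At price \<open>V / (4 * \<beta>)\<close> per unit, a
  load above \<open>\<beta>\<close> yields net revenue at least \<open>V / 8\<close>; without a
  stop, the ex-ante cost takes at most \<open>V / 8\<close> of \<open>V / 4\<close>.\<close>

lemma static_price_expected_value_ge:
  fixes b v y :: "nat \<Rightarrow> real"
  assumes I: "valid_instance I" and R: "valid_adversary I R"
    and v0: "\<And>t. 0 \<le> v t" and y0: "\<And>t. 0 \<le> y t"
    and vy: "\<And>t p. t < n_items I \<Longrightarrow> p \<ge> 0 \<Longrightarrow>
        ennreal (v t - p * y t) \<le> (\<integral>\<^sup>+ x. ennreal (x - p) \<partial>value_dist I t)"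
    and T: "T \<subseteq> {..<n_items I}" and b: "\<And>t. 0 \<le> b t" and \<beta>: "0 < \<beta>"
    and bud: "(\<Sum>t<n_items I. b t * y t) \<le> 2 * \<beta>"
  defines "V \<equiv> \<Sum>t\<in>T. v t"
  shows "ennreal (V / 8) \<le> expected_value I
      (stopping_policy T (\<lambda>S. \<beta> < (\<Sum>t\<in>S. b t)) (\<lambda>t S. V / (4 * \<beta>) * b t)) R"
proof -
  let ?n = "n_items I"
  define v' where "v' t = (if t \<in> T then 1/4 * v t else 0)" for t
  define y' where "y' t = (if t \<in> T then 1/4 * y t else 0)" for t
  have V0: "0 \<le> V" unfolding V_def using v0 by (intro sum_nonneg) auto
  have Vsum: "(\<Sum>t<?n. v' t) = V / 4"
    using T unfolding v'_def V_def
    by (subst sum.inter_restrict[symmetric]) (auto simp: Int_absorb1 sum_divide_distrib)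
  have bud': "(\<Sum>t<m. b t * y' t) \<le> \<beta> / 2" if "m \<le> ?n" for m
  proof -
    have "(\<Sum>t<m. b t * y' t) \<le> (\<Sum>t<m. 1/4 * (b t * y t))"
      using b y0 by (intro sum_mono) (auto simp: y'_def)
    also have "\<dots> \<le> (\<Sum>t<?n. 1/4 * (b t * y t))"
      using b y0 that by (intro sum_mono2) auto
    also have "\<dots> = 1/4 * (\<Sum>t<?n. b t * y t)" by (rule sum_distrib_left[symmetric])
    finally show ?thesis using bud by linarith
  qed
  have rev: "(\<Sum>t<m. V / (4 * \<beta>) * b t * (of_bool (t \<in> S) - y' t)) =
      V / (4 * \<beta>) * ((\<Sum>t\<in>S \<inter> {..<m}. b t) - (\<Sum>t<m. b t * y' t))" for m S
    unfolding sum_Int_lessThan sum_subtractf[symmetric] sum_distrib_left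
    by (simp add: right_diff_distrib mult.assoc)
  show ?thesis
  proof (rule stopping_policy_expected_value_ge[OF I R, where v = v' and y = y'])
    show "ennreal (v' t - p * y' t) \<le> (\<integral>\<^sup>+ x. ennreal (x - p) \<partial>value_dist I t)"
      if t: "t < ?n" and p: "0 \<le> p" for t p
    proof (cases "t \<in> T")
      case True
      then have "v' t - p * y' t = 1/4 * (v t - p * y t)"
        by (simp add: v'_def y'_def algebra_simps)
      then have "ennreal (v' t - p * y' t) \<le> ennreal (v t - p * y t)"
        by (metis ennreal_scale_le[of "1/4"] divide_le_eq_1_pos one_le_numeral zero_le_divide_1_iff zero_le_numeral zero_less_numeral)
      then show ?thesis using vy[OF t p] by order
    next
      case False
      then show ?thesis by (simp add: v'_def y'_def)
    qed
    show "V / 8 \<le> (\<Sum>t<m. V / (4 * \<beta>) * b t * (of_bool (t \<in> S) - y' t))"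
      if m: "m \<le> ?n" and stop: "\<beta> < (\<Sum>t\<in>S \<inter> {..<m}. b t)" for S m
    proof -
      have "V / (4 * \<beta>) * (\<beta> / 2) \<le> V / (4 * \<beta>) * ((\<Sum>t\<in>S \<inter> {..<m}. b t) - (\<Sum>t<m. b t * y' t))"
        using V0 \<beta> stop bud'[OF m] by (intro mult_left_mono) auto
      then show ?thesis unfolding rev using \<beta> by simp
    qed
    show "V / 8 \<le> (\<Sum>t<?n. v' t + V / (4 * \<beta>) * b t * (of_bool (t \<in> S) - y' t))" for S
    proof -
      have "0 \<le> (\<Sum>t\<in>S \<inter> {..<?n}. b t)" using b by (intro sum_nonneg) auto
      then have "V / (4 * \<beta>) * (- \<beta> / 2) \<le> V / (4 * \<beta>) * ((\<Sum>t\<in>S \<inter> {..<?n}. b t) - (\<Sum>t<?n. b t * y' t))"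
        using V0 \<beta> bud'[of ?n] by (intro mult_left_mono) auto
      then show ?thesis unfolding sum.distrib rev Vsum using \<beta> by simp
    qed
  qed (use V0 \<beta> b v0 in \<open>auto simp: v'_def y'_def\<close>)
qed

lemma ennreal_mult_le_of_sum:
  assumes "0 \<le> c" "ennreal V = opt_base I" "0 \<le> V" "c * V \<le> K"
  shows "ennreal c * opt_base I \<le> ennreal K"
proof -
  have "ennreal c * opt_base I = ennreal (c * V)"
    using assms by (simp add: ennreal_mult' flip: assms(2))
  then show ?thesis using assms by (simp add: ennreal_leI)
qed

section \<open>Competitive policies\<close>

text \<open>A small item fits while the load is at most \<open>B / 2\<close>. Two large items never
  fit together, so large items are counted instead of measured and at most one is bought. Keeping
  one class costs a factor \<open>1/2\<close>, the static price \<open>1/8\<close>.\<close>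

lemma competitive_policy_one_dim:
  assumes I: "valid_instance I" and B: "0 \<le> budget I" and d: "n_dims I = 1"
    and fin: "opt_base I < \<infinity>"
  shows "\<exists>P. competitive_policy I (1/16) P"
proof -
  let ?n = "n_items I"
  define B where "B = budget I"
  define a where "a t = item_size I t 0" for t
  have B0: "0 \<le> B" using B by (simp add: B_def)
  have a0: "0 \<le> a t" if "t < ?n" for t
    using I d that by (auto simp: valid_instance_def a_def)
  have feas: "feasible I S \<longleftrightarrow> S \<subseteq> {..<?n} \<and> (\<Sum>t\<in>S. a t) \<le> B" for S
    by (simp add: feasible_def d a_def B_def)
  obtain v y :: "nat \<Rightarrow> real" where v0: "\<And>t. 0 \<le> v t" and y0: "\<And>t. 0 \<le> y t"
    and opt: "ennreal (\<Sum>t<?n. v t) = opt_base I"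
    and lin: "\<And>b \<beta>. (\<And>S. feasible I S \<Longrightarrow> (\<Sum>t\<in>S. b t) \<le> \<beta>) \<Longrightarrow> (\<Sum>t<?n. b t * y t) \<le> \<beta>"
    and vz: "\<And>t. (\<And>S. feasible I S \<Longrightarrow> t \<notin> S) \<Longrightarrow> v t = 0"
    and vy: "\<And>t p. t < ?n \<Longrightarrow> 0 \<le> p \<Longrightarrow>
        ennreal (v t - p * y t) \<le> (\<integral>\<^sup>+ x. ennreal (x - p) \<partial>value_dist I t)"
    by (fact ex_ante_relaxation[OF I B fin])
  define T1 where "T1 = {t. t < ?n \<and> a t \<le> B / 2}"
  define T2 where "T2 = {t. t < ?n \<and> B / 2 < a t \<and> a t \<le> B}"
  have fT: "finite T1" "finite T2" by (auto simp: T1_def T2_def)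
  have T: "T1 \<subseteq> {..<?n}" "T2 \<subseteq> {..<?n}" by (auto simp: T1_def T2_def)
  have single: "a t \<le> B" if "feasible I S" "t \<in> S" for t S
  proof -
    have "a t \<le> (\<Sum>t\<in>S. a t)"
      using that a0 finite_subset[of S "{..<?n}"] by (intro member_le_sum) (auto simp: feas)
    then show ?thesis using that by (simp add: feas)
  qed
  have "(\<Sum>t<?n. v t) = (\<Sum>t\<in>T1 \<union> T2. v t)"
  proof (rule sum.mono_neutral_right)
    show "\<forall>t\<in>{..<?n} - (T1 \<union> T2). v t = 0"
    proof
      fix t assume t: "t \<in> {..<?n} - (T1 \<union> T2)"
      have "B / 2 \<le> B" using B0 by simp
      then have "B < a t" using t by (auto simp: T1_def T2_def)
      then show "v t = 0" using single by (intro vz) fastforce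
    qed
  qed (use T in auto)
  also have "\<dots> = (\<Sum>t\<in>T1. v t) + (\<Sum>t\<in>T2. v t)"
    using fT by (intro sum.union_disjoint) (auto simp: T1_def T2_def)
  finally have split: "(\<Sum>t<?n. v t) = (\<Sum>t\<in>T1. v t) + (\<Sum>t\<in>T2. v t)" .
  have vn: "0 \<le> (\<Sum>t<?n. v t)" using v0 by (intro sum_nonneg) auto
  have val: "ennreal (1/16) * opt_base I \<le> expected_value I P R"
    if "(\<Sum>t<?n. v t) / 2 \<le> V" "ennreal (V / 8) \<le> expected_value I P R" for V P R
    using ennreal_mult_le_of_sum[OF _ opt vn, of "1/16" "V / 8"] that by (simp add: order_trans)
  show ?thesis
  proof (cases "(\<Sum>t<?n. v t) / 2 \<le> (\<Sum>t\<in>T1. v t)")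
    case True
    \<comment> \<open>The threshold must be positive; for \<open>B = 0\<close> the items of this
      class have size zero, and the value one is a dummy.\<close>
    define \<beta> where "\<beta> = (if B = 0 then 1 else B / 2)"
    define b where "b t = (if t < ?n then a t else 0)" for t
    have \<beta>: "0 < \<beta>" "B \<le> 2 * \<beta>" using B0 by (auto simp: \<beta>_def)
    have bS: "(\<Sum>t\<in>S. b t) = (\<Sum>t\<in>S. a t)" if "S \<subseteq> {..<?n}" for S
      using that by (intro sum.cong) (auto simp: b_def)
    have "(\<Sum>t<?n. b t * y t) \<le> 2 * \<beta>"
    proof (rule lin)
      fix S assume "feasible I S"
      then show "(\<Sum>t\<in>S. b t) \<le> 2 * \<beta>" using bS \<beta> by (simp add: feas)
    qed
    note bound = static_price_expected_value_ge[OF I _ v0 y0 vy T(1) _ \<beta>(1) this]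
    let ?P = "stopping_policy T1 (\<lambda>S. \<beta> < (\<Sum>t\<in>S. b t)) (\<lambda>t S. (\<Sum>t\<in>T1. v t) / (4 * \<beta>) * b t)"
    have "competitive_policy I (1/16) ?P"
    proof (rule competitive_stopping_policy[OF B])
      fix t S assume S: "t < ?n" "S \<subseteq> {..<t}" "feasible I S" "S \<subseteq> T1" "t \<in> T1"
          "\<not> \<beta> < (\<Sum>t\<in>S. b t)"
      have "t \<notin> S" "finite S" using S(2) finite_subset by auto
      moreover have "a t + (\<Sum>t\<in>S. a t) \<le> B"
      proof (cases "B = 0")
        case True
        then show ?thesis using S by (auto simp: feas T1_def)
      next
        case False
        then show ?thesis using S bS by (auto simp: feas T1_def \<beta>_def)
      qed
      ultimately show "feasible I (insert t S)" using S by (auto simp: feas)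
    next
      fix R assume "valid_adversary I R"
      from bound[OF this] show "ennreal (1/16) * opt_base I \<le> expected_value I ?P R"
        using True a0 by (intro val) (auto simp: b_def)
    qed
    then show ?thesis by blast
  next
    case False
    \<comment> \<open>With unit loads and threshold \<open>1/2\<close>, the first purchase ends the
      sale; the bound \<open>2 * (1/2)\<close> below says that a feasible set holds at most one
      large item.\<close>
    define b :: "nat \<Rightarrow> real" where "b t = of_bool (t \<in> T2)" for t
    have "(\<Sum>t<?n. b t * y t) \<le> 2 * (1/2)"
    proof (rule lin)
      fix S assume S: "feasible I S"
      then have fS: "finite S" using finite_subset by (auto simp: feas)
      have "card (S \<inter> T2) \<le> Suc 0"
      proof (rule ccontr)
        assume "\<not> card (S \<inter> T2) \<le> Suc 0"
        then obtain s t where st: "s \<in> S \<inter> T2" "t \<in> S \<inter> T2" "s \<noteq> t"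
          using card_le_Suc0_iff_eq[of "S \<inter> T2"] fS by blast
        have "(\<Sum>t\<in>{s, t}. a t) \<le> (\<Sum>t\<in>S. a t)"
          using st S fS a0 by (intro sum_mono2) (auto simp: feas)
        then show False using st S by (auto simp: feas T2_def)
      qed
      moreover have "(\<Sum>t\<in>S. b t) = real (card (S \<inter> T2))"
        unfolding b_def using fS by simp
      ultimately show "(\<Sum>t\<in>S. b t) \<le> 2 * (1/2)" by simp
    qed
    note bound = static_price_expected_value_ge[OF I _ v0 y0 vy T(2) _ _ this]
    let ?P = "stopping_policy T2 (\<lambda>S. 1/2 < (\<Sum>t\<in>S. b t)) (\<lambda>t S. (\<Sum>t\<in>T2. v t) / (4 * (1/2)) * b t)"
    have "competitive_policy I (1/16) ?P"
    proof (rule competitive_stopping_policy[OF B])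
      fix t S assume S: "t < ?n" "S \<subseteq> {..<t}" "feasible I S" "S \<subseteq> T2" "t \<in> T2"
          "\<not> 1/2 < (\<Sum>t\<in>S. b t)"
      have fS: "finite S" using S(2) finite_subset by auto
      have "(\<Sum>t\<in>S. b t) = real (card S)"
        using S(4) fS by (simp add: b_def Int_absorb2)
      then have "S = {}" using S(6) fS by (cases "card S") auto
      then show "feasible I (insert t S)" using S(1,5) by (simp add: feas T2_def)
    next
      fix R assume "valid_adversary I R"
      from bound[OF this] show "ennreal (1/16) * opt_base I \<le> expected_value I ?P R"
        using False split by (intro val) (auto simp: b_def)
    qed
    then show ?thesis by blast
  qed
qed

text \<open>At rate \<open>1/16\<close> the regret \<open>r\<close> is at most
  \<open>32 * ln d\<close>, and \<open>ln d \<ge> 1/2\<close> gives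
  \<open>7/8 + r \<le> 34 * ln d \<le> B / 16\<close>; hence the constant
  \<open>544 = 16 * 34\<close>. The halved ex-ante solution is worth \<open>V / 2\<close>: without a
  stop the regret costs at most \<open>V / 16\<close>, and a stop certifies
  \<open>V / 4\<close>.\<close>

lemma competitive_policy_multi_dim:
  assumes I: "valid_instance I" and d: "2 \<le> n_dims I"
    and BC: "544 * ln (real (n_dims I)) \<le> budget I"
    and fin: "opt_base I < \<infinity>"
  shows "\<exists>P. competitive_policy I (1/4) P"
proof -
  let ?n = "n_items I" and ?d = "n_dims I"
  define B where "B = budget I"
  define a where "a t i = (if t < ?n then item_size I t i else 0)" for t i
  have ln2: "1/2 \<le> ln (real ?d)"
  proof -
    have "1/2 \<le> ln (2::real)" using ln2_ge_two_thirds by simp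
    also have "\<dots> \<le> ln (real ?d)" using d by simp
    finally show ?thesis .
  qed
  have lnd: "ln (1 + real ?d) \<le> 2 * ln (real ?d)"
  proof -
    have "1 + real ?d \<le> real ?d * real ?d"
    proof -
      have "2 * real ?d \<le> real ?d * real ?d" using d by (intro mult_right_mono) auto
      moreover have "2 \<le> real ?d" using d by simp
      ultimately show ?thesis by linarith
    qed
    then have "ln (1 + real ?d) \<le> ln (real ?d * real ?d)" using d by simp
    also have "\<dots> = 2 * ln (real ?d)" using d by (simp add: ln_mult)
    finally show ?thesis .
  qed
  have B: "0 \<le> budget I" and B0: "0 < B" using BC ln2 by (auto simp: B_def)
  have a01: "0 \<le> a t i" "a t i \<le> 1" if "i < ?d" for t i
    using I that by (auto simp: valid_instance_def a_def)
  have aS: "(\<Sum>t\<in>S. a t i) = (\<Sum>t\<in>S. item_size I t i)" if "S \<subseteq> {..<?n}" for S i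
    using that by (intro sum.cong) (auto simp: a_def)
  obtain v y :: "nat \<Rightarrow> real" where v0: "\<And>t. 0 \<le> v t" and y0: "\<And>t. 0 \<le> y t"
    and opt: "ennreal (\<Sum>t<?n. v t) = opt_base I"
    and lin: "\<And>b \<beta>. (\<And>S. feasible I S \<Longrightarrow> (\<Sum>t\<in>S. b t) \<le> \<beta>) \<Longrightarrow> (\<Sum>t<?n. b t * y t) \<le> \<beta>"
    and "\<And>t. (\<And>S. feasible I S \<Longrightarrow> t \<notin> S) \<Longrightarrow> v t = 0"
    and vy: "\<And>t p. t < ?n \<Longrightarrow> 0 \<le> p \<Longrightarrow>
        ennreal (v t - p * y t) \<le> (\<integral>\<^sup>+ x. ennreal (x - p) \<partial>value_dist I t)"
    by (fact ex_ante_relaxation[OF I B fin])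
  define V where "V = (\<Sum>t<?n. v t)"
  have V0: "0 \<le> V" unfolding V_def using v0 by (intro sum_nonneg) auto
  \<comment> \<open>The linear bound applied to the indicator of one item.\<close>
  have y1: "y t \<le> 1" if t: "t < ?n" for t
  proof -
    have "(\<Sum>s<?n. of_bool (s = t) * y s) \<le> 1"
    proof (rule lin)
      fix S assume "feasible I S"
      then have "finite S" using finite_subset by (auto simp: feasible_def)
      then show "(\<Sum>s\<in>S. of_bool (s = t)) \<le> (1::real)" by (simp add: of_bool_def)
    qed
    then show ?thesis using t by (simp add: of_bool_def if_distrib[of "\<lambda>x. x * _"] cong: if_cong)
  qed
  have yload: "(\<Sum>t<m. a t i * y t) \<le> B" if "m \<le> ?n" "i < ?d" for m i
  proof -
    have "(\<Sum>t<m. a t i * y t) \<le> (\<Sum>t<?n. a t i * y t)"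
      using a01 y0 that by (intro sum_mono2) auto
    also have "\<dots> \<le> B"
    proof (rule lin)
      fix S assume "feasible I S"
      then show "(\<Sum>t\<in>S. a t i) \<le> B" using that aS by (auto simp: feasible_def B_def)
    qed
    finally show ?thesis .
  qed
  \<comment> \<open>Actual minus halved ex-ante load of item \<open>t\<close> in coordinate
    \<open>i\<close>. With prices proportional to the weighted size, net revenue becomes
    \<open>V / B\<close> times the expected gain.\<close>
  define g where "g S t i = a t i * (of_bool (t \<in> S) - y t / 2)" for S t i
  define pr where "pr t S = V / B * (\<Sum>i<?d. mw_prob (1/16) ?d (g S) t i * a t i)" for t S
  \<comment> \<open>One unit of slack: sizes are at most one, so an item bought before the stop
    cannot overrun the budget.\<close>
  define stop where "stop S \<longleftrightarrow> (\<exists>i<?d. B - 1 < (\<Sum>t\<in>S. a t i))" for S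
  have g1: "\<bar>g S t i\<bar> \<le> 1" and g2: "(g S t i)\<^sup>2 \<le> a t i * (of_bool (t \<in> S) + y t / 2)"
    if i: "i < ?d" for S t i
  proof -
    have "\<bar>g S t i\<bar> \<le> 1 \<and> (g S t i)\<^sup>2 \<le> a t i * (of_bool (t \<in> S) + y t / 2)"
    proof (cases "t < ?n")
      case True
      have x: "\<bar>of_bool (t \<in> S) - y t / 2\<bar> \<le> 1" "\<bar>of_bool (t \<in> S) - y t / 2\<bar> \<le> of_bool (t \<in> S) + y t / 2"
        using y0[of t] y1[OF True] by auto
      have abs: "\<bar>g S t i\<bar> = a t i * \<bar>of_bool (t \<in> S) - y t / 2\<bar>"
        unfolding g_def abs_mult using a01(1)[OF i, of t] by simp
      also have "\<dots> \<le> 1 * 1" using a01[OF i, of t] x by (intro mult_mono) auto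
      finally have 1: "\<bar>g S t i\<bar> \<le> 1" by simp
      have "(g S t i)\<^sup>2 = \<bar>g S t i\<bar> * \<bar>g S t i\<bar>" by (simp add: power2_eq_square)
      also have "\<dots> \<le> 1 * \<bar>g S t i\<bar>" using 1 by (intro mult_right_mono) auto
      also have "\<dots> \<le> a t i * (of_bool (t \<in> S) + y t / 2)"
        unfolding abs using x(2) a01(1)[OF i, of t] by (simp add: mult_left_mono)
      finally show ?thesis using 1 by simp
    next
      case False
      then show ?thesis by (simp add: g_def a_def)
    qed
    then show "\<bar>g S t i\<bar> \<le> 1" "(g S t i)\<^sup>2 \<le> a t i * (of_bool (t \<in> S) + y t / 2)" by auto
  qed
  define G where "G S m = (\<Sum>t<m. \<Sum>i<?d. mw_prob (1/16) ?d (g S) t i * g S t i)" for S m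
  have prG: "(\<Sum>t<m. pr t (S \<inter> {..<t}) * (of_bool (t \<in> S) - y t / 2)) = V / B * G S m" for S m
  proof -
    \<comment> \<open>The price knows only the picks before \<open>t\<close>, but so do the weights,
      so the full set may be substituted.\<close>
    have "mw_prob (1/16) ?d (g (S \<inter> {..<t})) t i = mw_prob (1/16) ?d (g S) t i" for t i
      by (rule mw_prob_cong) (simp add: g_def)
    then have "pr t (S \<inter> {..<t}) * (of_bool (t \<in> S) - y t / 2) =
        V / B * (\<Sum>i<?d. mw_prob (1/16) ?d (g S) t i * g S t i)" for t
      by (simp add: pr_def g_def sum_distrib_left sum_distrib_right mult_ac)
    then show ?thesis by (simp add: G_def sum_distrib_left)
  qed
  define r where "r = ln (1 + real ?d) / (1/16)"
  have regret: "r \<le> B / 16"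
    using lnd BC ln2 by (simp add: B_def r_def)
  have G_ge: "- B / 16 \<le> G S m" for S m
  proof -
    have "- r \<le> G S m"
      unfolding G_def r_def minus_divide_left by (rule mw_regret(1)) (use g1 in auto)
    then show ?thesis using regret by simp
  qed
  have G_stop: "B / 4 \<le> G S m" if m: "m \<le> ?n" and stop: "stop (S \<inter> {..<m})" for S m
  proof -
    obtain i where i: "i < ?d" and load: "B - 1 < (\<Sum>t\<in>S \<inter> {..<m}. a t i)"
      using stop by (auto simp: stop_def)
    have L: "(\<Sum>t\<in>S \<inter> {..<m}. a t i) = (\<Sum>t<m. a t i * of_bool (t \<in> S))"
      by (rule sum_Int_lessThan)
    \<comment> \<open>The quadratic term carries \<open>2 * (1/16) = 1/8\<close>; by
      \<open>g2\<close> it lowers the coefficient of the actual load from \<open>1\<close> to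
      \<open>7/8\<close> and raises that of the ex-ante load from \<open>1/2\<close> to
      \<open>9/16\<close>.\<close>
    have "7/8 * (\<Sum>t<m. a t i * of_bool (t \<in> S)) - 9/16 * (\<Sum>t<m. a t i * y t) =
        (\<Sum>t<m. 7/8 * (a t i * of_bool (t \<in> S)) - 9/16 * (a t i * y t))"
      by (simp only: sum_distrib_left sum_subtractf)
    also have "\<dots> \<le> (\<Sum>t<m. g S t i - 2 * (1/16) * (g S t i)\<^sup>2)"
    proof (rule sum_mono)
      fix t
      show "7/8 * (a t i * of_bool (t \<in> S)) - 9/16 * (a t i * y t) \<le> g S t i - 2 * (1/16) * (g S t i)\<^sup>2"
        using g2[OF i, of S t] by (simp add: g_def algebra_simps)
    qed
    also have "\<dots> \<le> G S m + r"
    proof -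
      have "(\<Sum>t<m. g S t i - 2 * (1/16) * (g S t i)\<^sup>2) - r \<le> G S m"
        unfolding G_def r_def by (rule mw_regret(2)[OF _ _ _ i]) (use g1 in auto)
      then show ?thesis by linarith
    qed
    finally have "7/8 * (B - 1) - 9/16 * B - r \<le> G S m"
      using load yload[OF m i] unfolding L by argo
    moreover have "7/8 + r \<le> B / 16"
      using lnd BC ln2 by (simp add: B_def r_def)
    \<comment> \<open>\<open>7/8 - 9/16 = 5/16\<close>, of which the slack and the regret use at
      most \<open>1/16\<close>.\<close>
    ultimately show ?thesis by argo
  qed
  have "competitive_policy I (1/4) (stopping_policy UNIV stop pr)"
  proof (rule competitive_stopping_policy[OF B])
    fix t S assume S: "t < ?n" "S \<subseteq> {..<t}" "feasible I S" "\<not> stop S"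
    have tS: "t \<notin> S" "finite S" "S \<subseteq> {..<?n}" using S(1,2) finite_subset by auto
    have "(\<Sum>s\<in>insert t S. item_size I s i) \<le> budget I" if i: "i < ?d" for i
    proof -
      have "(\<Sum>s\<in>insert t S. a s i) \<le> 1 + (B - 1)"
      proof -
        have "\<not> B - 1 < (\<Sum>s\<in>S. a s i)" using S(4) i unfolding stop_def by blast
        then show ?thesis using a01(2)[OF i, of t] tS by simp
      qed
      then show ?thesis using aS[of "insert t S" i] S(1) tS by (simp add: B_def)
    qed
    then show "feasible I (insert t S)" using S tS by (auto simp: feasible_def)
  next
    fix R assume R: "valid_adversary I R"
    have "ennreal (V / 4) \<le> expected_value I (stopping_policy UNIV stop pr) R"
    proof (rule stopping_policy_expected_value_ge[OF I R,
          where v = "\<lambda>t. v t / 2" and y = "\<lambda>t. y t / 2"])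
      show "0 \<le> pr t S" for t S
        unfolding pr_def using V0 B0 a01(1) g1
        by (intro mult_nonneg_nonneg sum_nonneg mw_prob_nonneg divide_nonneg_nonneg) auto
      show "ennreal (v t / 2 - p * (y t / 2)) \<le> (\<integral>\<^sup>+ x. ennreal (x - p) \<partial>value_dist I t)"
        if t: "t < ?n" and p: "0 \<le> p" for t p
        using ennreal_scale_le[of "1/2" "v t - p * y t"] vy[OF t p]
        by (simp add: diff_divide_distrib)
      show "V / 4 \<le> (\<Sum>t<m. pr t (S \<inter> {..<t}) * (of_bool (t \<in> S) - y t / 2))"
        if "m \<le> ?n" "stop (S \<inter> {..<m})" for S m
      proof -
        have "V / B * (B / 4) \<le> V / B * G S m"
          using G_stop[OF that] V0 B0 by (intro mult_left_mono) auto
        then show ?thesis unfolding prG using B0 by simp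
      qed
      show "V / 4 \<le> (\<Sum>t<?n. v t / 2 + pr t (S \<inter> {..<t}) * (of_bool (t \<in> S) - y t / 2))" for S
      proof -
        have "V / B * (- B / 16) \<le> V / B * G S ?n"
          using G_ge V0 B0 by (intro mult_left_mono) auto
        then have "- V / 16 \<le> V / B * G S ?n" using B0 by simp
        moreover have "(\<Sum>t<?n. v t / 2) = V / 2" by (simp add: V_def sum_divide_distrib)
        ultimately show ?thesis unfolding sum.distrib prG using V0 by simp
      qed
    qed (use v0 in auto)
    moreover have "ennreal (1/4) * opt_base I \<le> ennreal (V / 4)"
      using opt V0 by (intro ennreal_mult_le_of_sum[where V = V]) (auto simp: V_def)
    ultimately show "ennreal (1/4) * opt_base I \<le> expected_value I (stopping_policy UNIV stop pr) R"
      by order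
  qed
  then show ?thesis by blast
qed

theorem theorem1p3:
  "\<exists>(c::real)>0. \<exists>(C::real)>0. \<exists>A :: online_algorithm.
     \<forall>I. valid_instance I \<and> budget I \<ge> C * ln (real (n_dims I)) \<longrightarrow>
       measurable_policy I (A I) \<and>
       (\<forall>R. valid_adversary I R \<longrightarrow>
          (\<forall>v. (\<forall>t<n_items I. 0 \<le> v t) \<longrightarrow> feasible I (picked I (A I) R v)) \<and>
          expected_value I (A I) R \<ge> ennreal c * opt_base I)"
proof -
  have "\<exists>P. competitive_policy I (1/16) P"
    if I: "valid_instance I" and BC: "budget I \<ge> 544 * ln (real (n_dims I))" for I
  proof -
    have d: "1 \<le> n_dims I" using I by (simp add: valid_instance_def)
    \<comment> \<open>For one dimension the logarithm vanishes, and nonnegativity is all that the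
      budget hypothesis provides.\<close>
    then have B: "0 \<le> budget I" using BC by (smt (verit) ln_ge_zero of_nat_1 of_nat_mono)
    consider "opt_base I = \<infinity>" | "opt_base I < \<infinity>" "n_dims I = 1" | "opt_base I < \<infinity>" "2 \<le> n_dims I"
      using d by (cases "opt_base I = \<infinity>"; cases "n_dims I = 1") (auto simp: less_top)
    then show ?thesis
    proof cases
      case 1
      then show ?thesis by (rule infinite_opt_policy[OF I B])
    next
      case 2
      then show ?thesis by (intro competitive_policy_one_dim[OF I B])
    next
      case 3
      then obtain P where P: "competitive_policy I (1/4) P"
        using competitive_policy_multi_dim[OF I _ BC] by blast
      \<comment> \<open>The smaller of the two ratios serves all cases.\<close>
      have "ennreal (1/16) * opt_base I \<le> ennreal (1/4) * opt_base I"
        by (intro mult_right_mono ennreal_leI) auto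
      then have "competitive_policy I (1/16) P"
        using P unfolding competitive_policy_def by (meson order_trans)
      then show ?thesis by blast
    qed
  qed
  then obtain A where A: "\<And>I. valid_instance I \<Longrightarrow> budget I \<ge> 544 * ln (real (n_dims I)) \<Longrightarrow>
      competitive_policy I (1/16) (A I)"
    by metis
  show ?thesis
    using A unfolding competitive_policy_def
    by (intro exI[of _ "1/16"] exI[of _ 544] exI[of _ A] conjI) auto
qed

end
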